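(* Let $\Omega$ be a slice domain in $\mathbb{H}$ and let $f:\Omega\to\mathbb{H}$ be a slice regular function such that $f\not\equiv0$. Then the regular reciprocal $f^{-*}$ is a slice regular function on $\Omega'=\Omega\setminus Z(f^s)$ and the following equalities hold in $\Omega'$: $$f^{-*}(q)=\big((f^s)^{-*}*f^c\big)(q)=f^s(q)^{-1}f^c(q),$$ $$f*f^{-*}=f^{-*}*f\equiv1.$$ Moreover, if $f$ is slice preserving, then $f^{-*}$ is slice preserving and $f^{-*}(q)=f(q)^{-1}$ for all $q\in\Omega'$.
   Context: $\mathbb{H}$ is the real algebra of quaternions, $\mathbb{S}=\{J\in\mathbb{H}:J^2=-1\}$, $L_I=\mathbb{R}+I\mathbb{R}$ and $T_I=T\cap L_I$ for $I\in\mathbb{S}$, $T\subseteq\mathbb{H}$. For $q=x+yI$ ($x,y\in\mathbb{R}$, $I\in\mathbb{S}$), $\operatorname{Re}(q)=x$ and $\operatorname{Im}(q)=yI$. A domain is a nonempty open connected set; a slice domain is a domain $\Omega\subseteq\mathbb{H}$ with $\Omega\cap\mathbb{R}\neq\emptyset$ such that $\Omega_I$ is a domain of $L_I$ for every $I\in\mathbb{S}$. A function $f:\Omega\to\mathbb{H}$ is slice regular if, for every $I\in\mathbb{S}$, the restriction $f_I$ of $f$ to $\Omega_I$ has continuous partial derivatives and $\frac12\left(\frac{\partial}{\partial x}+I\frac{\partial}{\partial y}\right)f_I(x+yI)\equiv0$. It is slice preserving if $f(\Omega_I)\subseteq L_I$ for all $I\in\mathbb{S}$. $Z(f)$ denotes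 the zero set of $f$. Spherical value and derivative: for a slice regular $f$ on a slice domain $\Omega$ and $p_0=x_0+y_0I_0\in\Omega\setminus\mathbb{R}$ ($y_0>0$, $I_0\in\mathbb{S}$), it is known that there exist a neighborhood $U\subseteq\Omega$ of $p_0$ in $x_0+y_0\mathbb{S}=\{x_0+y_0J:J\in\mathbb{S}\}$ and unique quaternions $b(p_0),c(p_0)$ (independent of $U$) with $f(x_0+y_0I)=b(p_0)+I\,c(p_0)$ for all $x_0+y_0I\in U$. Set $f^\circ_s(p_0)=b(p_0)$ and $f'_s(p_0)=y_0^{-1}c(p_0)$; for $p_0\in\Omega\cap\mathbb{R}$ set $f^\circ_s(p_0)=f(p_0)$. Operations: for $q\in\Omega\setminus\mathbb{R}$, $(f*g)(q)=f^\circ_s(q)g^\circ_s(q)+\operatorname{Im}(q)^2f'_s(q)g'_s(q)+\operatorname{Im}(q)\big(f^\circ_s(q)g'_s(q)+f'_s(q)g^\circ_s(q)\big)$, $f^c(q)=\overline{f^\circ_s(q)}+\operatorname{Im}(q)\overline{f'_s(q)}$, $f^s(q)=|f^\circ_s(q)|^2-|\operatorname{Im}(q)f'_s(q)|^2+2\operatorname{Im}(q)\operatorname{Re}\big(f^\circ_s(q)\overline{f'_s(q)}\big)$; for $q\in\Omega\cap\mathbb{R}$, $(f*g)(q)=f(q)g(q)$, $f^c(q)=\overline{f(q)}$, $f^s(q)=|f(q)|^2$. The functions $f*g$, $f^c$, $f^s$ are slice regular on $\Omega$. Regular reciprocal: for $a,b\in\mathbb{H}$ with $|a|\neq|b|$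 or $\operatorname{Re}(a\bar b)\neq0$, set $$\Phi(a,b)=\frac{|a|^2\bar a+\bar b a\bar b}{(|a|^2-|b|^2)^2+(2\operatorname{Re}(a\bar b))^2}.$$ For a slice regular $f\not\equiv0$ on a slice domain $\Omega$, the set $\Omega'=\Omega\setminus Z(f^s)$ is a slice domain and $f^{-*}:\Omega'\to\mathbb{H}$ is defined by $$f^{-*}(q)=\Phi\big(f^\circ_s(q),|\operatorname{Im}(q)|f'_s(q)\big)-\frac{\operatorname{Im}(q)}{|\operatorname{Im}(q)|}\Phi\big(|\operatorname{Im}(q)|f'_s(q),f^\circ_s(q)\big)$$ for $q\in\Omega'\setminus\mathbb{R}$ and $f^{-*}(q)=f(q)^{-1}$ for $q\in\Omega'\cap\mathbb{R}$. In products such as $f*f^{-*}$ the functions are restricted to $\Omega'$. *)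

theory Defs
  imports "HOL-Analysis.Analysis"
begin

section \<open>The real algebra of quaternions\<close>

datatype quat = Quat (qre: real) (qi: real) (qj: real) (qk: real)

lemma quat_eq_iff: "p = q \<longleftrightarrow> qre p = qre q \<and> qi p = qi q \<and> qj p = qj q \<and> qk p = qk q"
  by (auto intro: quat.expand)

instantiation quat :: ring_1
begin

definition zero_quat :: quat where "0 = Quat 0 0 0 0"
definition one_quat :: quat where "1 = Quat 1 0 0 0"
definition uminus_quat :: "quat \<Rightarrow> quat" where
  "- p = Quat (- qre p) (- qi p) (- qj p) (- qk p)"
definition plus_quat :: "quat \<Rightarrow> quat \<Rightarrow> quat" where
  "p + q = Quat (qre p + qre q) (qi p + qi q) (qj p + qj q) (qk p + qk q)"
definition minus_quat :: "quat \<Rightarrow> quat \<Rightarrow> quat" where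
  "p - q = Quat (qre p - qre q) (qi p - qi q) (qj p - qj q) (qk p - qk q)"
definition times_quat :: "quat \<Rightarrow> quat \<Rightarrow> quat" where
  "p * q = Quat
     (qre p * qre q - qi p * qi q - qj p * qj q - qk p * qk q)
     (qre p * qi q + qi p * qre q + qj p * qk q - qk p * qj q)
     (qre p * qj q - qi p * qk q + qj p * qre q + qk p * qi q)
     (qre p * qk q + qi p * qj q - qj p * qi q + qk p * qre q)"

instance
proof
  fix p q r :: quat
  show "p * q * r = p * (q * r)"
    by (simp add: times_quat_def; algebra)
  show "(p + q) * r = p * r + q * r" "r * (p + q) = r * p + r * q"
    by (simp_all add: times_quat_def plus_quat_def ring_distribs)
qed (simp_all add: quat_eq_iff zero_quat_def one_quat_def uminus_quat_def plus_quat_def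
      minus_quat_def times_quat_def)

end

lemma quat_sel_simps [simp]:
  "qre 0 = 0" "qi 0 = 0" "qj 0 = 0" "qk 0 = 0"
  "qre 1 = 1" "qi 1 = 0" "qj 1 = 0" "qk 1 = 0"
  "qre (- p) = - qre p" "qi (- p) = - qi p" "qj (- p) = - qj p" "qk (- p) = - qk p"
  "qre (p + q) = qre p + qre q" "qi (p + q) = qi p + qi q"
  "qj (p + q) = qj p + qj q" "qk (p + q) = qk p + qk q"
  "qre (p - q) = qre p - qre q" "qi (p - q) = qi p - qi q"
  "qj (p - q) = qj p - qj q" "qk (p - q) = qk p - qk q"
  "qre (p * q) = qre p * qre q - qi p * qi q - qj p * qj q - qk p * qk q"
  "qi (p * q) = qre p * qi q + qi p * qre q + qj p * qk q - qk p * qj q"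
  "qj (p * q) = qre p * qj q - qi p * qk q + qj p * qre q + qk p * qi q"
  "qk (p * q) = qre p * qk q + qi p * qj q - qj p * qi q + qk p * qre q"
  by (simp_all add: zero_quat_def one_quat_def uminus_quat_def plus_quat_def
      minus_quat_def times_quat_def)

instantiation quat :: real_algebra_1
begin

definition scaleR_quat :: "real \<Rightarrow> quat \<Rightarrow> quat" where
  "r *\<^sub>R p = Quat (r * qre p) (r * qi p) (r * qj p) (r * qk p)"

instance
  by standard (simp_all add: quat_eq_iff scaleR_quat_def algebra_simps)

end

lemma quat_scaleR_simps [simp]:
  "qre (r *\<^sub>R p) = r * qre p" "qi (r *\<^sub>R p) = r * qi p"
  "qj (r *\<^sub>R p) = r * qj p" "qk (r *\<^sub>R p) = r * qk p"
  by (simp_all add: scaleR_quat_def)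

lemma quat_of_real_simps [simp]:
  "qre (of_real r) = r" "qi (of_real r) = 0" "qj (of_real r) = 0" "qk (of_real r) = 0"
  by (simp_all add: of_real_def)

instantiation quat :: real_inner
begin

definition inner_quat :: "quat \<Rightarrow> quat \<Rightarrow> real" where
  "p \<bullet> q = qre p * qre q + qi p * qi q + qj p * qj q + qk p * qk q"
definition norm_quat :: "quat \<Rightarrow> real" where
  "norm p = sqrt ((qre p)\<^sup>2 + (qi p)\<^sup>2 + (qj p)\<^sup>2 + (qk p)\<^sup>2)"
definition sgn_quat :: "quat \<Rightarrow> quat" where
  "sgn (p :: quat) = p /\<^sub>R norm p"
definition dist_quat :: "quat \<Rightarrow> quat \<Rightarrow> real" where
  "dist (p :: quat) q = norm (p - q)"
definition uniformity_quat :: "(quat \<times> quat) filter" where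
  "uniformity = (INF e\<in>{0<..}. principal {(p :: quat, q). dist p q < e})"
definition open_quat :: "quat set \<Rightarrow> bool" where
  "open (U :: quat set) \<longleftrightarrow> (\<forall>p\<in>U. eventually (\<lambda>(p', q). p' = p \<longrightarrow> q \<in> U) uniformity)"

instance
proof
  fix p q r :: quat and a :: real
  show "p \<bullet> p = 0 \<longleftrightarrow> p = 0"
  proof
    assume "p \<bullet> p = 0"
    then have "(qre p)\<^sup>2 + ((qi p)\<^sup>2 + ((qj p)\<^sup>2 + (qk p)\<^sup>2)) = 0"
      by (simp add: inner_quat_def power2_eq_square)
    then show "p = 0"
      by (simp add: quat_eq_iff add_nonneg_eq_0_iff)
  qed (simp add: inner_quat_def)
qed (simp_all add: inner_quat_def norm_quat_def sgn_quat_def dist_quat_def uniformity_quat_def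
      open_quat_def power2_eq_square algebra_simps)

end

definition qcnj :: "quat \<Rightarrow> quat"
  where "qcnj p = Quat (qre p) (- qi p) (- qj p) (- qk p)"

lemma qcnj_simps [simp]:
  "qre (qcnj p) = qre p" "qi (qcnj p) = - qi p" "qj (qcnj p) = - qj p" "qk (qcnj p) = - qk p"
  by (simp_all add: qcnj_def)

lemma norm_quat_power2: "(norm p)\<^sup>2 = (qre p)\<^sup>2 + (qi p)\<^sup>2 + (qj p)\<^sup>2 + (qk p)\<^sup>2"
  by (simp add: norm_quat_def)

lemma mult_qcnj: "p * qcnj p = of_real ((norm p)\<^sup>2)" "qcnj p * p = of_real ((norm p)\<^sup>2)"
  unfolding norm_quat_power2
  by (simp_all add: quat_eq_iff power2_eq_square del: of_real_power of_real_add of_real_mult)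

instantiation quat :: real_normed_div_algebra
begin

definition inverse_quat :: "quat \<Rightarrow> quat" where
  "inverse p = qcnj p /\<^sub>R (norm p)\<^sup>2"
definition divide_quat :: "quat \<Rightarrow> quat \<Rightarrow> quat" where
  "(p :: quat) div q = p * inverse q"

instance
proof
  fix p q :: quat
  show "inverse p * p = 1" if "p \<noteq> 0"
    using that by (simp add: inverse_quat_def mult_qcnj del: of_real_power)
      (simp add: of_real_def)
  show "p * inverse p = 1" if "p \<noteq> 0"
    using that by (simp add: inverse_quat_def mult_qcnj del: of_real_power)
      (simp add: of_real_def)
  show "p div q = p * inverse q"
    by (simp add: divide_quat_def)
  show "inverse (0 :: quat) = 0"
    by (simp add: inverse_quat_def)
  have "(norm (p * q))\<^sup>2 = (norm p * norm q)\<^sup>2"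
    unfolding power_mult_distrib norm_quat_power2 by (simp add: power2_eq_square algebra_simps)
  then show "norm (p * q) = norm p * norm q"
    by (metis norm_ge_zero mult_nonneg_nonneg power2_eq_imp_eq)
qed

end

definition qim :: "quat \<Rightarrow> quat"
  where "qim q = q - of_real (qre q)"


section \<open>Slices, slice domains and slice regular functions\<close>

definition imag_units :: "quat set"
  where "imag_units = {J. J\<^sup>2 = - 1}"

definition slice_pt :: "quat \<Rightarrow> real \<Rightarrow> real \<Rightarrow> quat"
  where "slice_pt I x y = of_real x + of_real y * I"

definition slice_plane :: "quat \<Rightarrow> quat set"
  where "slice_plane I = {slice_pt I x y | x y. True}"

definition slice_domain :: "quat set \<Rightarrow> bool"
  where "slice_domain \<Omega> \<longleftrightarrow>
    \<Omega> \<noteq> {} \<and> open \<Omega> \<and> connected \<Omega> \<and> \<Omega> \<inter> \<real> \<noteq> {} \<and>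
    (\<forall>I\<in>imag_units. \<Omega> \<inter> slice_plane I \<noteq> {} \<and>
       openin (top_of_set (slice_plane I)) (\<Omega> \<inter> slice_plane I) \<and>
       connected (\<Omega> \<inter> slice_plane I))"

text \<open>
  A function on \<open>\<Omega>\<close> is represented by a total function, of which only the values
  on \<open>\<Omega>\<close> matter (\<open>\<Omega>\<close> is open, so this includes the derivatives below).
  The functions \<open>fx\<close> and \<open>fy\<close> are the two partial derivatives of
  \<open>(x, y) \<mapsto> f (x + y I)\<close>, written as functions of the point \<open>x + y I\<close>.
\<close>

definition slice_regular_on :: "quat set \<Rightarrow> (quat \<Rightarrow> quat) \<Rightarrow> bool"
  where "slice_regular_on \<Omega> f \<longleftrightarrow>
    (\<forall>I\<in>imag_units. \<exists>fx fy.
       continuous_on (\<Omega> \<inter> slice_plane I) fx \<and>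
       continuous_on (\<Omega> \<inter> slice_plane I) fy \<and>
       (\<forall>x y. slice_pt I x y \<in> \<Omega> \<longrightarrow>
          ((\<lambda>t. f (slice_pt I t y)) has_vector_derivative fx (slice_pt I x y)) (at x) \<and>
          ((\<lambda>t. f (slice_pt I x t)) has_vector_derivative fy (slice_pt I x y)) (at y) \<and>
          (1 / 2) *\<^sub>R (fx (slice_pt I x y) + I * fy (slice_pt I x y)) = 0))"

definition slice_preserving_on :: "quat set \<Rightarrow> (quat \<Rightarrow> quat) \<Rightarrow> bool"
  where "slice_preserving_on \<Omega> f \<longleftrightarrow>
    (\<forall>I\<in>imag_units. f ` (\<Omega> \<inter> slice_plane I) \<subseteq> slice_plane I)"

definition zero_set :: "quat set \<Rightarrow> (quat \<Rightarrow> quat) \<Rightarrow> quat set"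
  where "zero_set \<Omega> f = {q \<in> \<Omega>. f q = 0}"


section \<open>Spherical value and spherical derivative\<close>

definition sphere_through :: "quat \<Rightarrow> quat set"
  where "sphere_through p = {slice_pt J (qre p) (norm (qim p)) | J. J \<in> imag_units}"

definition spherical_coeffs :: "quat set \<Rightarrow> (quat \<Rightarrow> quat) \<Rightarrow> quat \<Rightarrow> quat \<times> quat"
  where "spherical_coeffs \<Omega> f p = (THE (b, c).
    \<exists>U. U \<subseteq> \<Omega> \<and> openin (top_of_set (sphere_through p)) U \<and> p \<in> U \<and>
      (\<forall>I\<in>imag_units. slice_pt I (qre p) (norm (qim p)) \<in> U \<longrightarrow>
         f (slice_pt I (qre p) (norm (qim p))) = b + I * c))"

definition sph_value :: "quat set \<Rightarrow> (quat \<Rightarrow> quat) \<Rightarrow> quat \<Rightarrow> quat"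
  where "sph_value \<Omega> f p = (if p \<in> \<real> then f p else fst (spherical_coeffs \<Omega> f p))"

text \<open>The spherical derivative is only meaningful, and only used, off the real axis.\<close>

definition sph_deriv :: "quat set \<Rightarrow> (quat \<Rightarrow> quat) \<Rightarrow> quat \<Rightarrow> quat"
  where "sph_deriv \<Omega> f p = snd (spherical_coeffs \<Omega> f p) /\<^sub>R norm (qim p)"


section \<open>Operations on slice regular functions\<close>

text \<open>
  The first argument of each operation is the common domain of its function arguments;
  the spherical value and derivative depend on it.
\<close>

definition regular_prod :: "quat set \<Rightarrow> (quat \<Rightarrow> quat) \<Rightarrow> (quat \<Rightarrow> quat) \<Rightarrow> quat \<Rightarrow> quat"
  where "regular_prod \<Omega> f g q =
    (if q \<in> \<real> then f q * g q
     else sph_value \<Omega> f q * sph_value \<Omega> g q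
        + (qim q)\<^sup>2 * sph_deriv \<Omega> f q * sph_deriv \<Omega> g q
        + qim q * (sph_value \<Omega> f q * sph_deriv \<Omega> g q + sph_deriv \<Omega> f q * sph_value \<Omega> g q))"

definition regular_conj :: "quat set \<Rightarrow> (quat \<Rightarrow> quat) \<Rightarrow> quat \<Rightarrow> quat"
  where "regular_conj \<Omega> f q =
    (if q \<in> \<real> then qcnj (f q)
     else qcnj (sph_value \<Omega> f q) + qim q * qcnj (sph_deriv \<Omega> f q))"

definition symmetrization :: "quat set \<Rightarrow> (quat \<Rightarrow> quat) \<Rightarrow> quat \<Rightarrow> quat"
  where "symmetrization \<Omega> f q =
    (if q \<in> \<real> then of_real ((norm (f q))\<^sup>2)
     else of_real ((norm (sph_value \<Omega> f q))\<^sup>2) - of_real ((norm (qim q * sph_deriv \<Omega> f q))\<^sup>2)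
        + 2 * qim q * of_real (qre (sph_value \<Omega> f q * qcnj (sph_deriv \<Omega> f q))))"

definition recip_coeff :: "quat \<Rightarrow> quat \<Rightarrow> quat"
  where "recip_coeff a b =
    (of_real ((norm a)\<^sup>2) * qcnj a + qcnj b * a * qcnj b)
      /\<^sub>R (((norm a)\<^sup>2 - (norm b)\<^sup>2)\<^sup>2 + (2 * qre (a * qcnj b))\<^sup>2)"

definition recip_domain :: "quat set \<Rightarrow> (quat \<Rightarrow> quat) \<Rightarrow> quat set"
  where "recip_domain \<Omega> f = \<Omega> - zero_set \<Omega> (symmetrization \<Omega> f)"

text \<open>
  Here \<open>\<Omega>\<close> is the domain of \<open>f\<close>; the reciprocal itself is a function
  on \<open>recip_domain \<Omega> f\<close>.
\<close>

definition regular_recip :: "quat set \<Rightarrow> (quat \<Rightarrow> quat) \<Rightarrow> quat \<Rightarrow> quat"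
  where "regular_recip \<Omega> f q =
    (if q \<in> \<real> then inverse (f q)
     else recip_coeff (sph_value \<Omega> f q) (norm (qim q) *\<^sub>R sph_deriv \<Omega> f q)
        - (qim q /\<^sub>R norm (qim q))
            * recip_coeff (norm (qim q) *\<^sub>R sph_deriv \<Omega> f q) (sph_value \<Omega> f q))"

end

theory Submission
  imports Defs "HOL-Complex_Analysis.Complex_Analysis"
begin

text \<open>
  Fix an imaginary unit \<open>I\<close> and regard \<open>f\<close> on the slice of \<open>I\<close> as a function of
  \<open>z = x + \<i> y\<close>.  Slice regularity says that its real differential is left-linear over the
  slice, so the functionals \<open>\<langle>f, v\<rangle> + \<i> \<langle>f, I v\<rangle>\<close> are holomorphic
  (\<open>slice_diff_functional\<close>).  This gives the identity principle: slice regular functions that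
  agree on the real points of a slice domain are equal.

  The key step is the local representation formula (\<open>local_stem\<close>).  A path from a real point to
  the given point inside one slice has a neighbourhood \<open>N\<close> that lies in the domain for all
  nearby slices.  The values of \<open>f\<close> on two of these slices determine functions \<open>b\<close> and
  \<open>c\<close> on \<open>N\<close> such that \<open>b + \<iota> c\<close> is holomorphic into the
  complexified quaternions, and by the identity principle \<open>f (x + y J) = b + J c\<close> for all
  units \<open>J\<close> near \<open>I\<close>.  Hence \<open>b\<close> and \<open>c\<close> are the spherical
  coefficients of \<open>f\<close>, and all operations become operations in the complexified quaternions:
  with \<open>F = b + \<iota> c\<close>, the conjugate is \<open>F\<^sup>c\<close> with coefficients conjugated, the
  symmetrization is \<open>F F\<^sup>c\<close>, which lies in the centre \<open>\<complex>\<close>, and the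
  reciprocal is \<open>(F F\<^sup>c)\<^sup>-\<^sup>1 F\<^sup>c\<close> (\<open>recip_coeff_conj\<close>).  The algebraic
  identities are then statements about single quaternions (\<open>reciprocal_identities\<close>), and
  regularity of the reciprocal holds because it is, on each slice, the product of a holomorphic
  function into the slice and the slice regular function \<open>f\<^sup>c\<close>.

  On a slice, the symmetrization is a holomorphic function into that slice (locally the sum of the
  squares of the four complex components of \<open>F\<close>).  By the identity principle \<open>f\<close> does not
  vanish at some real point, and there the symmetrization is not zero; so its zeros in each slice
  are countable and removing them leaves the slice connected.  What remains of the slices has a
  real point in common, so the new domain is a slice domain (\<open>slice_domain_recip_domain\<close>).

  Finally, a slice preserving function is real on the real axis, hence agrees with its conjugate
  there and so everywhere; its spherical coefficients are therefore real, and the reciprocal reduces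
  to the pointwise inverse (\<open>slice_preserving_recip\<close>).
\<close>

section \<open>Slices as copies of the complex plane\<close>

lemma imag_units_iff:
  "I \<in> imag_units \<longleftrightarrow> qre I = 0 \<and> (qi I)\<^sup>2 + (qj I)\<^sup>2 + (qk I)\<^sup>2 = 1"
proof
  assume "I \<in> imag_units"
  then have sq: "I * I = - 1"
    by (simp add: imag_units_def power2_eq_square)
  have re: "qre I * qre I - qi I * qi I - qj I * qj I - qk I * qk I = - 1"
    using arg_cong[OF sq, of qre] by simp
  have im: "qre I * qi I = 0" "qre I * qj I = 0" "qre I * qk I = 0"
    using arg_cong[OF sq, of qi] arg_cong[OF sq, of qj] arg_cong[OF sq, of qk]
    by (simp_all add: mult.commute)
  have "qre I = 0"
  proof (rule ccontr)
    assume "qre I \<noteq> 0"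
    then have "qi I = 0" "qj I = 0" "qk I = 0"
      using im by auto
    then have "qre I * qre I = - 1"
      using re by simp
    then show False
      by (metis neg_0_le_iff_le not_one_le_zero zero_le_square)
  qed
  then show "qre I = 0 \<and> (qi I)\<^sup>2 + (qj I)\<^sup>2 + (qk I)\<^sup>2 = 1"
    using re by (simp add: power2_eq_square)
next
  assume "qre I = 0 \<and> (qi I)\<^sup>2 + (qj I)\<^sup>2 + (qk I)\<^sup>2 = 1"
  then show "I \<in> imag_units"
    by (simp add: imag_units_def power2_eq_square quat_eq_iff)
qed

lemma imag_unit_sq: "I \<in> imag_units \<Longrightarrow> I * I = - 1"
  by (simp add: imag_units_def power2_eq_square)

lemma imag_unit_sq_mult: "I \<in> imag_units \<Longrightarrow> I * (I * q) = - q"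
  by (simp add: imag_unit_sq flip: mult.assoc)

lemma imag_unit_minus: "I \<in> imag_units \<Longrightarrow> - I \<in> imag_units"
  by (simp add: imag_units_def)

lemma imag_unit_norm: "I \<in> imag_units \<Longrightarrow> norm I = 1"
  by (simp add: imag_units_iff norm_quat_def)

lemma inner_imag_unit:
  assumes "I \<in> imag_units"
  shows "(I * p) \<bullet> q = - (p \<bullet> (I * q))" "(I * p) \<bullet> (I * q) = p \<bullet> q"
proof -
  show skew: "(I * p) \<bullet> q = - (p \<bullet> (I * q))" for p q
    using assms by (simp add: imag_units_iff inner_quat_def algebra_simps)
  show "(I * p) \<bullet> (I * q) = p \<bullet> q"
    by (simp add: skew imag_unit_sq_mult[OF assms] inner_minus_right)
qed

text \<open>
  The embedding \<open>x + \<i> y \<mapsto> x + y I\<close> of the complex plane onto the slice of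
  \<open>I\<close>; it is multiplicative when \<open>I\<close> is an imaginary unit.
\<close>

definition slice_embed :: "quat \<Rightarrow> complex \<Rightarrow> quat"
  where "slice_embed I z = slice_pt I (Re z) (Im z)"

lemma slice_embed_eq: "slice_embed I z = Re z *\<^sub>R 1 + Im z *\<^sub>R I"
  by (simp add: slice_embed_def slice_pt_def scaleR_conv_of_real)

lemma slice_pt_eq_embed: "slice_pt I x y = slice_embed I (Complex x y)"
  by (simp add: slice_embed_def)

lemma bounded_linear_slice_embed: "bounded_linear (slice_embed I)"
  unfolding slice_embed_eq
  by (intro bounded_linear_add bounded_linear_scaleR_const bounded_linear_Re bounded_linear_Im)

lemmas slice_embed_simps =
  linear_0[OF bounded_linear.linear[OF bounded_linear_slice_embed]]
  linear_add[OF bounded_linear.linear[OF bounded_linear_slice_embed]]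
  linear_diff[OF bounded_linear.linear[OF bounded_linear_slice_embed]]
  linear_neg[OF bounded_linear.linear[OF bounded_linear_slice_embed]]

lemma continuous_slice_embed [continuous_intros]:
  "continuous_on S g \<Longrightarrow> continuous_on S h \<Longrightarrow>
    continuous_on S (\<lambda>z. slice_embed (g z) (h z))"
  unfolding slice_embed_eq by (intro continuous_intros)

lemma slice_embed_mult:
  "I \<in> imag_units \<Longrightarrow> slice_embed I (z * w) = slice_embed I z * slice_embed I w"
  by (simp add: slice_embed_eq algebra_simps imag_unit_sq)

lemma slice_embed_1 [simp]: "slice_embed I 1 = 1"
  by (simp add: slice_embed_eq)

lemma slice_embed_real: "Im z = 0 \<Longrightarrow> slice_embed I z = of_real (Re z)"
  by (simp add: slice_embed_eq scaleR_conv_of_real)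

text \<open>The inverse of \<open>slice_embed I\<close> on the slice of \<open>I\<close>.\<close>

definition slice_coord :: "quat \<Rightarrow> quat \<Rightarrow> complex"
  where "slice_coord I q = Complex (q \<bullet> 1) (q \<bullet> I)"

lemma bounded_linear_slice_coord: "bounded_linear (slice_coord I)"
proof -
  have "bounded_linear (\<lambda>q. of_real (q \<bullet> 1) + \<i> * of_real (q \<bullet> I) :: complex)"
    by (intro bounded_linear_add bounded_linear_const_mult bounded_linear_compose[OF bounded_linear_of_real]
        bounded_linear_inner_left)
  moreover have "slice_coord I = (\<lambda>q. of_real (q \<bullet> 1) + \<i> * of_real (q \<bullet> I))"
    by (simp add: fun_eq_iff slice_coord_def Complex_eq)
  ultimately show ?thesis
    by simp
qed

lemma slice_coord_embed: "I \<in> imag_units \<Longrightarrow> slice_coord I (slice_embed I z) = z"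
  by (simp add: slice_coord_def complex_eq_iff slice_embed_eq inner_quat_def imag_units_iff
      power2_eq_square flip: distrib_left mult.assoc)
   (simp add: mult.assoc flip: distrib_left)

lemma slice_embed_eq_0_iff: "I \<in> imag_units \<Longrightarrow> slice_embed I z = 0 \<longleftrightarrow> z = 0"
  by (metis slice_coord_embed slice_embed_simps(1))

lemma slice_embed_inverse:
  assumes "I \<in> imag_units"
  shows "slice_embed I (inverse z) = inverse (slice_embed I z)"
proof (cases "z = 0")
  case False
  then have "slice_embed I (inverse z) * slice_embed I z = 1"
    by (simp flip: slice_embed_mult[OF assms])
  then show ?thesis
    by (metis inverse_unique mult.commute inverse_inverse_eq)
qed (simp add: slice_embed_simps)

lemma slice_plane_eq: "slice_plane I = range (slice_embed I)"
  by (auto simp: slice_plane_def slice_embed_def image_iff) (metis complex.sel)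

lemma slice_plane_Int_eq: "\<Omega> \<inter> slice_plane I = slice_embed I ` (slice_embed I -` \<Omega>)"
  by (auto simp: slice_plane_eq)

lemma open_slice: "open \<Omega> \<Longrightarrow> open (slice_embed I -` \<Omega>)"
  by (rule open_vimage) (auto intro!: continuous_intros)

lemma qre_slice_embed: "I \<in> imag_units \<Longrightarrow> qre (slice_embed I z) = Re z"
  by (simp add: slice_embed_eq imag_units_iff)

lemma qim_slice_embed: "I \<in> imag_units \<Longrightarrow> qim (slice_embed I z) = Im z *\<^sub>R I"
  by (simp add: slice_embed_eq qim_def imag_units_iff quat_eq_iff)

lemma norm_qim_slice_embed: "I \<in> imag_units \<Longrightarrow> norm (qim (slice_embed I z)) = \<bar>Im z\<bar>"
  by (simp add: qim_slice_embed imag_unit_norm)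

lemma qim_eq_0_iff: "qim q = 0 \<longleftrightarrow> q \<in> \<real>"
  by (metis Reals_cases Reals_of_real eq_iff_diff_eq_0 qim_def quat_of_real_simps(1))

lemma slice_embed_in_Reals_iff: "I \<in> imag_units \<Longrightarrow> slice_embed I z \<in> \<real> \<longleftrightarrow> Im z = 0"
  by (metis abs_zero norm_eq_zero norm_qim_slice_embed qim_eq_0_iff abs_eq_0)

lemma quat_unit_i: "Quat 0 1 0 0 \<in> imag_units"
  by (simp add: imag_units_iff)

lemma quat_unit_j: "Quat 0 0 1 0 \<in> imag_units"
  by (simp add: imag_units_iff)

lemma normalized_imag_unit:
  assumes "qre v = 0" "v \<noteq> 0"
  shows "v /\<^sub>R norm v \<in> imag_units"
proof -
  have "(qi v)\<^sup>2 + (qj v)\<^sup>2 + (qk v)\<^sup>2 = (norm v)\<^sup>2"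
    using assms by (simp add: norm_quat_power2)
  moreover have "norm v \<noteq> 0"
    using assms by simp
  ultimately show ?thesis
    using assms(1) by (simp add: imag_units_iff power_mult_distrib field_simps)
qed

text \<open>
  The coordinates of a nonreal quaternion \<open>x + y I\<close> with \<open>y > 0\<close>:
  the unit \<open>I\<close> and the point \<open>x + \<i> y\<close> of the upper half plane.
  At real points \<open>unit_of\<close> takes the irrelevant value \<open>0\<close>.
\<close>

definition unit_of :: "quat \<Rightarrow> quat"
  where "unit_of q = qim q /\<^sub>R norm (qim q)"

definition half_coord :: "quat \<Rightarrow> complex"
  where "half_coord q = Complex (qre q) (norm (qim q))"

lemma unit_of_imag_units: "q \<notin> \<real> \<Longrightarrow> unit_of q \<in> imag_units"
  unfolding unit_of_def by (rule normalized_imag_unit) (auto simp: qim_eq_0_iff, simp add: qim_def)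

lemma slice_embed_half_coord: "q \<notin> \<real> \<Longrightarrow> slice_embed (unit_of q) (half_coord q) = q"
  by (simp add: slice_embed_eq unit_of_def half_coord_def qim_eq_0_iff)
    (simp add: qim_def scaleR_conv_of_real)

lemma exists_slice: "\<exists>I\<in>imag_units. \<exists>z. q = slice_embed I z \<and> 0 \<le> Im z"
proof (cases "q \<in> \<real>")
  case True
  then obtain r where "q = of_real r"
    by (auto elim: Reals_cases)
  then have "q = slice_embed (Quat 0 1 0 0) (of_real r)"
    by (simp add: slice_embed_real)
  then show ?thesis
    using quat_unit_i by (metis Im_complex_of_real order_refl)
next
  case False
  then show ?thesis
    using unit_of_imag_units slice_embed_half_coord
    by (metis complex.sel(2) half_coord_def norm_ge_zero)
qed

lemma connected_slice:
  assumes "I \<in> imag_units"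
  shows "connected (\<Omega> \<inter> slice_plane I) \<longleftrightarrow> connected (slice_embed I -` \<Omega>)"
proof
  assume "connected (\<Omega> \<inter> slice_plane I)"
  then have "connected (slice_coord I ` (\<Omega> \<inter> slice_plane I))"
    by (intro connected_continuous_image linear_continuous_on bounded_linear_slice_coord)
  then show "connected (slice_embed I -` \<Omega>)"
    by (simp only: slice_plane_Int_eq image_image slice_coord_embed[OF assms] image_ident)
next
  assume "connected (slice_embed I -` \<Omega>)"
  then show "connected (\<Omega> \<inter> slice_plane I)"
    unfolding slice_plane_Int_eq
    by (intro connected_continuous_image linear_continuous_on bounded_linear_slice_embed)
qed

text \<open>Every imaginary unit is a limit of other imaginary units.\<close>

lemma imag_unit_not_isolated:
  assumes I: "I \<in> imag_units" and A: "open A" "I \<in> A"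
  shows "\<exists>J\<in>imag_units. J \<in> A \<and> J \<noteq> I"
proof -
  obtain K where K: "K \<in> imag_units" "K \<noteq> I" "K \<noteq> - I"
  proof (cases "Quat 0 1 0 0 = I \<or> Quat 0 1 0 0 = - I")
    case True
    then have "I = Quat 0 1 0 0 \<or> I = Quat 0 (-1) 0 0"
      by (auto simp: quat_eq_iff)
    then show ?thesis
      using quat_unit_j by (intro that[of "Quat 0 0 1 0"]) (auto simp: quat_eq_iff)
  qed (use quat_unit_i that in auto)
  define u where "u t = I + t *\<^sub>R K" for t :: real
  have unz: "u t \<noteq> 0" for t
  proof
    assume 0: "u t = 0"
    then have "I = - (t *\<^sub>R K)"
      by (simp add: u_def eq_neg_iff_add_eq_0)
    moreover from this have "\<bar>t\<bar> = 1"
      using imag_unit_norm[OF I] imag_unit_norm[OF K(1)] by simp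
    ultimately show False
      using K by (auto simp: abs_if split: if_splits)
  qed
  have u_unit: "u t /\<^sub>R norm (u t) \<in> imag_units" for t
    using I K(1) unz by (intro normalized_imag_unit) (auto simp: u_def imag_units_iff)
  have "continuous (at 0) (\<lambda>t. u t /\<^sub>R norm (u t))"
    using unz[of 0] unfolding u_def by (intro continuous_intros) auto
  moreover have "u 0 /\<^sub>R norm (u 0) = I"
    using imag_unit_norm[OF I] by (simp add: u_def)
  ultimately have "\<forall>\<^sub>F t in at 0. u t /\<^sub>R norm (u t) \<in> A"
    using A by (auto simp: continuous_at intro: topological_tendstoD)
  then have "\<forall>\<^sub>F t in at 0. t \<noteq> 0 \<and> u t /\<^sub>R norm (u t) \<in> A"
    by (simp add: eventually_conj_iff eventually_neq_at_within)
  then obtain t where t: "t \<noteq> 0" "u t /\<^sub>R norm (u t) \<in> A"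
    using eventually_happens'[OF at_neq_bot] by blast
  have "u t /\<^sub>R norm (u t) \<noteq> I"
  proof
    assume "u t /\<^sub>R norm (u t) = I"
    then have "u t = norm (u t) *\<^sub>R I"
      using unz[of t] by (metis norm_eq_zero scaleR_one right_inverse scaleR_scaleR)
    then have tK: "t *\<^sub>R K = (norm (u t) - 1) *\<^sub>R I"
      by (simp add: u_def algebra_simps)
    then have "\<bar>t\<bar> = \<bar>norm (u t) - 1\<bar>"
      using imag_unit_norm[OF I] imag_unit_norm[OF K(1)] by (metis mult.right_neutral norm_scaleR)
    then have "norm (u t) - 1 = t \<or> norm (u t) - 1 = - t"
      by linarith
    then have "t *\<^sub>R K = t *\<^sub>R I \<or> t *\<^sub>R K = t *\<^sub>R (- I)"
      using tK by auto
    then show False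
      using t(1) K by (metis scaleR_left_imp_eq)
  qed
  then show ?thesis
    using t u_unit by blast
qed

section \<open>Left-holomorphic functions on a slice\<close>

text \<open>
  The function \<open>g\<close> of a complex variable is differentiable at \<open>z\<close> and its real
  differential is left-linear over the slice of \<open>I\<close>.
\<close>

definition slice_diff :: "quat \<Rightarrow> (complex \<Rightarrow> quat) \<Rightarrow> complex \<Rightarrow> bool"
  where "slice_diff I g z \<longleftrightarrow>
    (\<exists>d. (g has_derivative (\<lambda>h. slice_embed I h * d)) (at z))"

lemma slice_diff_cong_open:
  assumes "slice_diff I g z" "open N" "z \<in> N" "\<And>w. w \<in> N \<Longrightarrow> g w = h w"
  shows "slice_diff I h z"
  using assms unfolding slice_diff_def by (blast intro: has_derivative_transform_within_open)

lemma slice_diff_diff: "slice_diff I g z \<Longrightarrow> slice_diff I h z \<Longrightarrow> slice_diff I (\<lambda>w. g w - h w) z"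
  unfolding slice_diff_def
  by (blast intro: has_derivative_eq_rhs[OF has_derivative_diff] right_diff_distrib[symmetric])

lemma slice_diff_add: "slice_diff I g z \<Longrightarrow> slice_diff I h z \<Longrightarrow> slice_diff I (\<lambda>w. g w + h w) z"
  unfolding slice_diff_def
  by (blast intro: has_derivative_eq_rhs[OF has_derivative_add] distrib_left[symmetric])

lemma slice_diff_const: "slice_diff I (\<lambda>_. c) z"
  unfolding slice_diff_def by (rule exI[of _ 0]) simp

text \<open>Functions holomorphic into the slice of \<open>I\<close> act by multiplication from the left.\<close>

lemma slice_diff_embed_mult:
  assumes I: "I \<in> imag_units" and \<phi>: "(\<phi> has_field_derivative \<phi>') (at z)" and g: "slice_diff I g z"
  shows "slice_diff I (\<lambda>w. slice_embed I (\<phi> w) * g w) z"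
proof -
  obtain d where d: "(g has_derivative (\<lambda>h. slice_embed I h * d)) (at z)"
    using g by (auto simp: slice_diff_def)
  have "((\<lambda>w. slice_embed I (\<phi> w)) has_derivative (\<lambda>h. slice_embed I (\<phi>' * h))) (at z)"
    using bounded_linear.has_derivative[OF bounded_linear_slice_embed
        \<phi>[unfolded has_field_derivative_def]] .
  from has_derivative_mult[OF this d]
  have "((\<lambda>w. slice_embed I (\<phi> w) * g w) has_derivative
      (\<lambda>h. slice_embed I h * (slice_embed I (\<phi> z) * d + slice_embed I \<phi>' * g z))) (at z)"
    by (rule has_derivative_eq_rhs)
      (simp add: fun_eq_iff distrib_left slice_embed_mult[OF I, symmetric] mult.commute
        flip: mult.assoc)
  then show ?thesis
    by (auto simp: slice_diff_def)
qed

text \<open>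
  The functionals \<open>q \<mapsto> \<langle>q, v\<rangle> + \<i> \<langle>q, I v\<rangle>\<close> are complex linear
  for the complex structure given by left multiplication by \<open>I\<close>, so they turn
  left-holomorphic functions into holomorphic ones.
\<close>

lemma slice_diff_functional:
  assumes I: "I \<in> imag_units" and d: "(g has_derivative (\<lambda>h. slice_embed I h * d)) (at z)"
  shows "((\<lambda>w. Complex (g w \<bullet> v) (g w \<bullet> (I * v))) has_field_derivative
           Complex (d \<bullet> v) (d \<bullet> (I * v))) (at z)"
proof -
  have "((\<lambda>w. of_real (g w \<bullet> v) + \<i> * of_real (g w \<bullet> (I * v))) has_derivative
      (\<lambda>h. of_real ((slice_embed I h * d) \<bullet> v) + \<i> * of_real ((slice_embed I h * d) \<bullet> (I * v)))) (at z)"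
    by (intro has_derivative_add has_derivative_mult_right has_derivative_of_real
        has_derivative_inner_left d)
  also have "(\<lambda>h. of_real ((slice_embed I h * d) \<bullet> v) + \<i> * of_real ((slice_embed I h * d) \<bullet> (I * v)))
      = (*) (Complex (d \<bullet> v) (d \<bullet> (I * v)))"
    by (simp add: fun_eq_iff complex_eq_iff slice_embed_eq distrib_right inner_add_left
        inner_imag_unit[OF I] imag_unit_sq_mult[OF I] algebra_simps)
  finally show ?thesis
    by (simp add: has_field_derivative_def Complex_eq)
qed

lemma slice_diff_identity:
  assumes I: "I \<in> imag_units" and D: "open D" "connected D" "complex_of_real x \<in> D"
    and g: "\<And>z. z \<in> D \<Longrightarrow> slice_diff I g z"
    and zero: "\<And>r. complex_of_real r \<in> D \<Longrightarrow> g (complex_of_real r) = 0"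
    and z: "z \<in> D"
  shows "g z = 0"
proof -
  \<comment> \<open>The functional with \<open>v = g z\<close>: at \<open>z\<close> its real part is the squared norm of \<open>g z\<close>.\<close>
  define h where "h w = Complex (g w \<bullet> g z) (g w \<bullet> (I * g z))" for w
  have "\<exists>d. (h has_field_derivative d) (at w)" if "w \<in> D" for w
    unfolding h_def using g[OF that] slice_diff_functional[OF I] unfolding slice_diff_def by blast
  then have hol: "h holomorphic_on D"
    using D(1) by (auto simp: holomorphic_on_open)
  have lim: "complex_of_real x islimpt D \<inter> \<real>"
  proof (subst islimpt_approachable, intro allI impI)
    fix e :: real assume "e > 0"
    obtain r where r: "r > 0" "ball (complex_of_real x) r \<subseteq> D"
      using D by (meson openE)
    define t where "t = x + min e r / 2"
    have "dist (complex_of_real t) (complex_of_real x) = min e r / 2"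
      using r \<open>e > 0\<close> by (simp add: t_def dist_norm flip: of_real_diff)
    then have "dist (complex_of_real t) (complex_of_real x) < r"
        "dist (complex_of_real t) (complex_of_real x) < e"
      using r \<open>e > 0\<close> by linarith+
    then show "\<exists>x'\<in>D \<inter> \<real>. x' \<noteq> complex_of_real x \<and> dist x' (complex_of_real x) < e"
      using r \<open>e > 0\<close> by (intro bexI[of _ "complex_of_real t"])
        (auto simp: t_def dist_commute)
  qed
  have "h z = 0"
  proof (rule analytic_continuation[OF hol D(1,2) _ D(3) lim _ z])
    show "h w = 0" if "w \<in> D \<inter> \<real>" for w
      using that zero by (auto simp: h_def Complex_eq_0 elim!: Reals_cases)
  qed simp
  then show "g z = 0"
    by (simp add: h_def complex_eq_iff)
qed

text \<open>Continuity of the partial derivatives gives total differentiability.\<close>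

lemma slice_regular_imp_slice_diff:
  assumes \<Omega>: "open \<Omega>" and f: "slice_regular_on \<Omega> f" and I: "I \<in> imag_units"
    and z: "slice_embed I z \<in> \<Omega>"
  shows "slice_diff I (\<lambda>w. f (slice_embed I w)) z"
proof -
  obtain fx fy where cont: "continuous_on (\<Omega> \<inter> slice_plane I) fy"
    and fx: "\<And>x y. slice_pt I x y \<in> \<Omega> \<Longrightarrow>
      ((\<lambda>t. f (slice_pt I t y)) has_vector_derivative fx (slice_pt I x y)) (at x)"
    and fy: "\<And>x y. slice_pt I x y \<in> \<Omega> \<Longrightarrow>
      ((\<lambda>t. f (slice_pt I x t)) has_vector_derivative fy (slice_pt I x y)) (at y)"
    and CR: "\<And>x y. slice_pt I x y \<in> \<Omega> \<Longrightarrow> fx (slice_pt I x y) + I * fy (slice_pt I x y) = 0"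
    using f I unfolding slice_regular_on_def by fastforce
  obtain r where r: "r > 0" "ball z r \<subseteq> slice_embed I -` \<Omega>"
    using open_slice[OF \<Omega>, of I] z by (meson openE vimageI)
  define X where "X = ball (Re z) (r / 2)"
  define Y where "Y = ball (Im z) (r / 2)"
  have XY: "slice_pt I x y \<in> \<Omega>" if "x \<in> X" "y \<in> Y" for x y
  proof -
    have "cmod (z - Complex x y) \<le> \<bar>Re z - x\<bar> + \<bar>Im z - y\<bar>"
      using cmod_le[of "z - Complex x y"] by simp
    also have "\<dots> < r"
      using that by (simp add: X_def Y_def dist_real_def)
    finally have "Complex x y \<in> ball z r"
      by (simp add: dist_norm)
    then show ?thesis
      using r by (auto simp: slice_pt_eq_embed)
  qed
  have z_in: "(Re z, Im z) \<in> X \<times> Y" and op: "open (X \<times> Y)"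
    using r by (auto simp: X_def Y_def open_Times)
  have cont': "continuous_on (X \<times> Y) (\<lambda>(x, y). blinfun_scaleR_left (fy (slice_pt I x y)))"
  proof -
    have "continuous_on (X \<times> Y) (\<lambda>p. fy (slice_embed I (Complex (fst p) (snd p))))"
    proof (rule continuous_on_compose2[OF cont])
      show "continuous_on (X \<times> Y) (\<lambda>p. slice_embed I (Complex (fst p) (snd p)))"
        unfolding Complex_eq by (intro continuous_intros)
    qed (use XY in \<open>auto simp: slice_plane_eq slice_pt_eq_embed\<close>)
    then show ?thesis
      by (simp add: slice_pt_eq_embed case_prod_unfold
          bounded_linear.continuous_on[OF bounded_linear_blinfun_scaleR_left])
  qed
  have "((\<lambda>(x, y). f (slice_pt I x y)) has_derivative
      (\<lambda>(tx, ty). tx *\<^sub>R fx (slice_embed I z) +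
         blinfun_scaleR_left (fy (slice_pt I (Re z) (Im z))) ty)) (at (Re z, Im z) within X \<times> Y)"
  proof (rule has_derivative_partialsI)
    show "((\<lambda>x. f (slice_pt I x (Im z))) has_derivative (\<lambda>tx. tx *\<^sub>R fx (slice_embed I z)))
        (at (Re z) within X)"
      using fx[of "Re z" "Im z"] z
      by (auto simp: has_vector_derivative_def slice_embed_def intro: has_derivative_at_withinI)
    show "((\<lambda>y. f (slice_pt I x y)) has_derivative
        blinfun_apply (blinfun_scaleR_left (fy (slice_pt I x y)))) (at y within Y)"
      if "x \<in> X" "y \<in> Y" for x y
      using fy[OF XY[OF that]]
      by (auto simp: has_vector_derivative_def intro: has_derivative_at_withinI)
    show "continuous (at (Re z, Im z) within X \<times> Y)
        (\<lambda>(x, y). blinfun_scaleR_left (fy (slice_pt I x y)))"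
      using cont' z_in by (simp add: continuous_on_eq_continuous_within)
  qed (use z_in in \<open>auto simp: Y_def\<close>)
  then have "((\<lambda>(x, y). f (slice_pt I x y)) has_derivative
      (\<lambda>(tx, ty). tx *\<^sub>R fx (slice_embed I z) + ty *\<^sub>R fy (slice_embed I z))) (at (Re z, Im z))"
    using at_within_open[OF z_in op] by (simp add: slice_embed_def)
  moreover have "((\<lambda>w. (Re w, Im w)) has_derivative (\<lambda>h. (Re h, Im h))) (at z)"
    by (auto intro!: derivative_eq_intros)
  ultimately have "((\<lambda>w. f (slice_embed I w)) has_derivative
      (\<lambda>h. Re h *\<^sub>R fx (slice_embed I z) + Im h *\<^sub>R fy (slice_embed I z))) (at z)"
    using has_derivative_compose[of "\<lambda>w. (Re w, Im w)" "\<lambda>h. (Re h, Im h)" z UNIV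
        "\<lambda>(x, y). f (slice_pt I x y)" "\<lambda>(tx, ty). tx *\<^sub>R fx (slice_embed I z) + ty *\<^sub>R fy (slice_embed I z)"]
    by (simp add: slice_embed_def)
  moreover have "fy (slice_embed I z) = I * fx (slice_embed I z)"
  proof -
    have "I * (fx (slice_embed I z) + I * fy (slice_embed I z)) = 0"
      using CR[of "Re z" "Im z"] z by (simp add: slice_embed_def)
    then show ?thesis
      by (simp add: distrib_left imag_unit_sq_mult[OF I])
  qed
  ultimately show ?thesis
    by (auto simp: slice_diff_def slice_embed_eq distrib_right)
qed

text \<open>
  Conversely, left-holomorphy on every slice gives slice regularity: the partial derivatives
  are continuous because the derivatives of the associated holomorphic functions are.
\<close>

lemma slice_diff_imp_slice_regular:
  assumes \<Omega>: "open \<Omega>"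
    and diff: "\<And>I z. I \<in> imag_units \<Longrightarrow> slice_embed I z \<in> \<Omega> \<Longrightarrow>
      slice_diff I (\<lambda>w. f (slice_embed I w)) z"
  shows "slice_regular_on \<Omega> f"
  unfolding slice_regular_on_def
proof
  fix I assume I: "I \<in> imag_units"
  define D where "D = slice_embed I -` \<Omega>"
  have D: "open D"
    unfolding D_def by (rule open_slice[OF \<Omega>])
  have "\<forall>z\<in>D. \<exists>d. ((\<lambda>w. f (slice_embed I w)) has_derivative (\<lambda>h. slice_embed I h * d)) (at z)"
    using diff[OF I] by (auto simp: D_def slice_diff_def)
  then obtain d where d: "\<And>z. z \<in> D \<Longrightarrow>
      ((\<lambda>w. f (slice_embed I w)) has_derivative (\<lambda>h. slice_embed I h * d z)) (at z)"
    by metis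
  have inner_cont: "continuous_on D (\<lambda>z. d z \<bullet> v)" for v
  proof -
    define h where "h w = Complex (f (slice_embed I w) \<bullet> v) (f (slice_embed I w) \<bullet> (I * v))" for w
    have h': "(h has_field_derivative Complex (d z \<bullet> v) (d z \<bullet> (I * v))) (at z)" if "z \<in> D" for z
      unfolding h_def using slice_diff_functional[OF I d[OF that]] .
    then have "h holomorphic_on D"
      using D by (auto simp: holomorphic_on_open)
    then have "continuous_on D (\<lambda>z. Re (deriv h z))"
      using D by (intro continuous_intros holomorphic_on_imp_continuous_on holomorphic_deriv)
    then show ?thesis
      by (rule continuous_on_eq) (simp add: DERIV_imp_deriv[OF h'])
  qed
  have d_cont: "continuous_on D d"
  proof -
    have "d z = (d z \<bullet> Quat 1 0 0 0) *\<^sub>R Quat 1 0 0 0 + (d z \<bullet> Quat 0 1 0 0) *\<^sub>R Quat 0 1 0 0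
        + (d z \<bullet> Quat 0 0 1 0) *\<^sub>R Quat 0 0 1 0 + (d z \<bullet> Quat 0 0 0 1) *\<^sub>R Quat 0 0 0 1" for z
      by (simp add: quat_eq_iff inner_quat_def)
    moreover have "continuous_on D (\<lambda>z. (d z \<bullet> Quat 1 0 0 0) *\<^sub>R Quat 1 0 0 0
        + (d z \<bullet> Quat 0 1 0 0) *\<^sub>R Quat 0 1 0 0
        + (d z \<bullet> Quat 0 0 1 0) *\<^sub>R Quat 0 0 1 0 + (d z \<bullet> Quat 0 0 0 1) *\<^sub>R Quat 0 0 0 1)"
      by (intro continuous_intros inner_cont)
    ultimately show ?thesis
      by (metis (no_types, lifting) continuous_on_cong)
  qed
  define fx where "fx q = d (slice_coord I q)" for q
  have coord: "slice_coord I (slice_pt I x y) = Complex x y" for x y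
    by (simp add: slice_pt_eq_embed slice_coord_embed[OF I])
  have cont: "continuous_on (\<Omega> \<inter> slice_plane I) fx"
    unfolding fx_def
    by (rule continuous_on_compose2[OF d_cont linear_continuous_on[OF bounded_linear_slice_coord]])
      (auto simp: slice_plane_Int_eq slice_coord_embed[OF I] D_def)
  show "\<exists>fx fy. continuous_on (\<Omega> \<inter> slice_plane I) fx \<and> continuous_on (\<Omega> \<inter> slice_plane I) fy \<and>
       (\<forall>x y. slice_pt I x y \<in> \<Omega> \<longrightarrow>
          ((\<lambda>t. f (slice_pt I t y)) has_vector_derivative fx (slice_pt I x y)) (at x) \<and>
          ((\<lambda>t. f (slice_pt I x t)) has_vector_derivative fy (slice_pt I x y)) (at y) \<and>
          (1 / 2) *\<^sub>R (fx (slice_pt I x y) + I * fy (slice_pt I x y)) = 0)"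
  proof (rule exI[of _ fx], rule exI[of _ "\<lambda>q. I * fx q"], intro conjI allI impI)
    fix x y assume "slice_pt I x y \<in> \<Omega>"
    then have "Complex x y \<in> D"
      by (simp add: D_def slice_pt_eq_embed)
    from d[OF this] have der: "((\<lambda>w. f (slice_embed I w)) has_derivative
        (\<lambda>h. slice_embed I h * fx (slice_pt I x y))) (at (Complex x y))"
      by (simp add: fx_def coord)
    have "((\<lambda>t. Complex t y) has_derivative (\<lambda>h. Complex h 0)) (at x)"
      unfolding Complex_eq by (auto intro!: derivative_eq_intros)
    from has_derivative_compose[OF this der]
    show "((\<lambda>t. f (slice_pt I t y)) has_vector_derivative fx (slice_pt I x y)) (at x)"
      by (simp add: has_vector_derivative_def slice_pt_eq_embed) (simp add: slice_embed_eq)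
    have "((\<lambda>t. Complex x t) has_derivative (\<lambda>h. Complex 0 h)) (at y)"
      unfolding Complex_eq by (auto intro!: derivative_eq_intros)
    from has_derivative_compose[OF this der]
    show "((\<lambda>t. f (slice_pt I x t)) has_vector_derivative I * fx (slice_pt I x y)) (at y)"
      by (simp add: has_vector_derivative_def slice_pt_eq_embed) (simp add: slice_embed_eq)
    show "(1 / 2) *\<^sub>R (fx (slice_pt I x y) + I * (I * fx (slice_pt I x y))) = 0"
      by (simp add: imag_unit_sq_mult[OF I])
  qed (use cont in \<open>auto intro!: continuous_intros\<close>)
qed

section \<open>Holomorphic stem functions\<close>

text \<open>
  A pair \<open>(b, c)\<close> stands for the function \<open>b + \<iota> c\<close> with values in the
  complexified quaternions, \<open>\<iota>\<close> being the new imaginary unit.  It is holomorphic when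
  all its complex-valued components \<open>\<langle>b, v\<rangle> + \<i> \<langle>c, v\<rangle>\<close> are.
\<close>

definition stem_holomorphic :: "complex set \<Rightarrow> (complex \<Rightarrow> quat) \<Rightarrow> (complex \<Rightarrow> quat) \<Rightarrow> bool"
  where "stem_holomorphic N b c \<longleftrightarrow> (\<forall>v. (\<lambda>z. Complex (b z \<bullet> v) (c z \<bullet> v)) holomorphic_on N)"

lemma stem_slice_diff:
  assumes I: "I \<in> imag_units" and N: "open N" "z \<in> N" and bc: "stem_holomorphic N b c"
  shows "slice_diff I (\<lambda>w. b w + I * c w) z"
proof -
  define S where "S v w = slice_embed I (Complex (b w \<bullet> v) (c w \<bullet> v)) * v" for v w
  have S: "slice_diff I (S v) z" for v
  proof -
    have "(\<lambda>w. Complex (b w \<bullet> v) (c w \<bullet> v)) holomorphic_on N"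
      using bc by (simp add: stem_holomorphic_def)
    then obtain \<phi>' where "((\<lambda>w. Complex (b w \<bullet> v) (c w \<bullet> v)) has_field_derivative \<phi>') (at z)"
      using N by (auto simp: holomorphic_on_open)
    then show ?thesis
      unfolding S_def by (rule slice_diff_embed_mult[OF I _ slice_diff_const])
  qed
  have "slice_diff I (\<lambda>w. S (Quat 1 0 0 0) w + S (Quat 0 1 0 0) w + S (Quat 0 0 1 0) w
      + S (Quat 0 0 0 1) w) z"
    by (intro slice_diff_add S)
  moreover have "b w + I * c w = S (Quat 1 0 0 0) w + S (Quat 0 1 0 0) w + S (Quat 0 0 1 0) w
      + S (Quat 0 0 0 1) w" for w
    by (simp add: S_def slice_embed_eq inner_quat_def quat_eq_iff algebra_simps)
  ultimately show ?thesis
    by simp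
qed

text \<open>The functions on two different slices determine a holomorphic stem function.\<close>

lemma stem_holomorphic_two_slices:
  assumes J: "J \<in> imag_units" and K: "K \<in> imag_units" and JK: "J \<noteq> K" and N: "open N"
    and g: "\<And>z. z \<in> N \<Longrightarrow> slice_diff J g z" and h: "\<And>z. z \<in> N \<Longrightarrow> slice_diff K h z"
    and c: "c = (\<lambda>z. inverse (J - K) * (g z - h z))" and b: "b = (\<lambda>z. g z - J * c z)"
  shows "stem_holomorphic N b c"
  unfolding stem_holomorphic_def
proof
  fix v
  define m where "m = inverse (J - K)"
  have m: "(J - K) * m = 1" "m * (J - K) = 1"
    using JK by (simp_all add: m_def)
  \<comment> \<open>Moving the units past \<open>m\<close> turns the two one-sided equations into the
     Cauchy-Riemann equations for \<open>(b, c)\<close>.\<close>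
  have Jm: "J * m = - (m * K)"
  proof -
    have "(J - K) * J = - (K * (J - K))"
      by (simp add: algebra_simps imag_unit_sq[OF J] imag_unit_sq[OF K])
    then have "m * ((J - K) * J) * m = m * (- (K * (J - K))) * m"
      by simp
    then have "(m * (J - K)) * J * m = - (m * K * ((J - K) * m))"
      by (simp add: mult.assoc)
    then show ?thesis
      by (simp add: m)
  qed
  have "\<exists>D. ((\<lambda>z. Complex (b z \<bullet> v) (c z \<bullet> v)) has_field_derivative D) (at z)" if "z \<in> N" for z
  proof -
    obtain d e
      where d: "(g has_derivative (\<lambda>u. slice_embed J u * d)) (at z)"
        and e: "(h has_derivative (\<lambda>u. slice_embed K u * e)) (at z)"
      using g h \<open>z \<in> N\<close> unfolding slice_diff_def by blast
    define P where "P = m * (J * d - K * e)"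
    define Q where "Q = m * (d - e)"
    have "J * Q = - (m * K * (d - e))"
      by (simp add: Q_def Jm flip: mult.assoc)
    then have "d - J * Q = m * (J - K) * d + m * K * (d - e)"
      by (simp add: m)
    also have "\<dots> = P"
      by (simp add: P_def algebra_simps)
    finally have dJQ: "d - J * Q = P" .
    have "J * d - J * P = J * (J * Q)"
      by (simp add: right_diff_distrib flip: dJQ)
    then have JP: "J * d - J * P = - Q"
      by (simp add: imag_unit_sq_mult[OF J])
    have "(c has_derivative (\<lambda>u. m * (slice_embed J u * d - slice_embed K u * e))) (at z)"
      unfolding c m_def by (intro has_derivative_mult_right has_derivative_diff d e)
    then have c': "(c has_derivative (\<lambda>u. Im u *\<^sub>R P + Re u *\<^sub>R Q)) (at z)"
      by (simp add: P_def Q_def slice_embed_eq algebra_simps)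
    have "(b has_derivative (\<lambda>u. slice_embed J u * d - J * (Im u *\<^sub>R P + Re u *\<^sub>R Q))) (at z)"
      unfolding b by (intro has_derivative_mult_right has_derivative_diff d c')
    moreover have "slice_embed J u * d - J * (Im u *\<^sub>R P + Re u *\<^sub>R Q)
        = Re u *\<^sub>R (d - J * Q) + Im u *\<^sub>R (J * d - J * P)" for u
      by (simp add: slice_embed_eq algebra_simps)
    ultimately have b': "(b has_derivative (\<lambda>u. Re u *\<^sub>R P - Im u *\<^sub>R Q)) (at z)"
      by (simp add: dJQ JP)
    have "((\<lambda>w. of_real (b w \<bullet> v) + \<i> * of_real (c w \<bullet> v)) has_derivative
        (\<lambda>u. of_real ((Re u *\<^sub>R P - Im u *\<^sub>R Q) \<bullet> v) + \<i> * of_real ((Im u *\<^sub>R P + Re u *\<^sub>R Q) \<bullet> v)))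
        (at z)"
      by (intro has_derivative_add has_derivative_mult_right has_derivative_of_real
          has_derivative_inner_left b' c')
    also have "(\<lambda>u. of_real ((Re u *\<^sub>R P - Im u *\<^sub>R Q) \<bullet> v)
        + \<i> * of_real ((Im u *\<^sub>R P + Re u *\<^sub>R Q) \<bullet> v)) = (*) (Complex (P \<bullet> v) (Q \<bullet> v))"
      by (simp add: fun_eq_iff complex_eq_iff inner_add_left inner_diff_left algebra_simps)
    finally show ?thesis
      by (auto simp: has_field_derivative_def Complex_eq)
  qed
  then show "(\<lambda>z. Complex (b z \<bullet> v) (c z \<bullet> v)) holomorphic_on N"
    using N by (auto simp: holomorphic_on_open)
qed

section \<open>The local representation formula\<close>

text \<open>
  Two slices give the stem function; the identity principle, applied along \<open>N\<close>, shows that it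
  represents \<open>f\<close> on every other slice as well.
\<close>

lemma local_stem_tube:
  assumes \<Omega>: "open \<Omega>" and f: "slice_regular_on \<Omega> f" and I: "I \<in> imag_units"
    and N: "open N" "connected N" "complex_of_real x \<in> N" and A: "open A" "I \<in> A"
    and NA: "\<And>J w. J \<in> imag_units \<Longrightarrow> J \<in> A \<Longrightarrow> w \<in> N \<Longrightarrow> slice_embed J w \<in> \<Omega>"
  obtains b c where "stem_holomorphic N b c"
    "\<And>J w. J \<in> imag_units \<Longrightarrow> J \<in> A \<Longrightarrow> w \<in> N \<Longrightarrow> f (slice_embed J w) = b w + J * c w"
proof -
  obtain J where J: "J \<in> imag_units" "J \<in> A" "J \<noteq> I"
    using imag_unit_not_isolated[OF I A] by blast
  define c where "c = (\<lambda>w. inverse (J - I) * (f (slice_embed J w) - f (slice_embed I w)))"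
  define b where "b = (\<lambda>w. f (slice_embed J w) - J * c w)"
  have diff: "slice_diff L (\<lambda>w. f (slice_embed L w)) w"
    if "L \<in> imag_units" "L \<in> A" "w \<in> N" for L w
    using slice_regular_imp_slice_diff[OF \<Omega> f that(1) NA[OF that]] .
  have stem: "stem_holomorphic N b c"
    using stem_holomorphic_two_slices[OF J(1) I J(3) N(1) diff[OF J(1,2)] diff[OF I A(2)] c_def b_def]
    by blast
  moreover have "f (slice_embed L w) = b w + L * c w"
    if L: "L \<in> imag_units" "L \<in> A" and w: "w \<in> N" for L w
  proof -
    have "f (slice_embed L w) - (b w + L * c w) = 0"
    proof (rule slice_diff_identity[OF L(1) N _ _ w])
      show "slice_diff L (\<lambda>w. f (slice_embed L w) - (b w + L * c w)) z" if "z \<in> N" for z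
        using that by (intro slice_diff_diff diff L stem_slice_diff[OF L(1) N(1) _ stem])
    qed (simp add: b_def c_def slice_embed_real)
    then show ?thesis
      by simp
  qed
  ultimately show ?thesis
    using that by blast
qed

lemma norm_slice_embed: "I \<in> imag_units \<Longrightarrow> norm (slice_embed I z) = cmod z"
proof -
  assume I: "I \<in> imag_units"
  have "(norm (slice_embed I z))\<^sup>2 = (cmod z)\<^sup>2"
    using I by (simp add: norm_quat_power2 cmod_power2 slice_embed_eq imag_units_iff
        power_mult_distrib add.assoc flip: distrib_left)
  then show ?thesis
    by (simp add: power2_eq_iff_nonneg)
qed

text \<open>
  Near each point, a slice regular function comes from a holomorphic stem function on a region
  \<open>N\<close> of the complex plane, simultaneously for all nearby imaginary units, and for
  all imaginary units if the point is real.  At a nonreal point \<open>N\<close> is a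
  neighbourhood of a path to the real axis; this is where the domain being a slice domain
  matters.
\<close>

lemma local_stem:
  assumes \<Omega>: "slice_domain \<Omega>" and f: "slice_regular_on \<Omega> f" and I: "I \<in> imag_units"
    and z: "slice_embed I z \<in> \<Omega>"
  obtains N A b c where "open N" "z \<in> N" "open A" "I \<in> A" "Im z = 0 \<Longrightarrow> A = UNIV"
    "stem_holomorphic N b c"
    "\<And>J w. J \<in> imag_units \<Longrightarrow> J \<in> A \<Longrightarrow> w \<in> N \<Longrightarrow> slice_embed J w \<in> \<Omega>"
    "\<And>J w. J \<in> imag_units \<Longrightarrow> J \<in> A \<Longrightarrow> w \<in> N \<Longrightarrow> f (slice_embed J w) = b w + J * c w"
proof (cases "Im z = 0")
  case True
  have op: "open \<Omega>"
    using \<Omega> by (simp add: slice_domain_def)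
  define x where "x = Re z"
  have zx: "z = of_real x"
    using True by (simp add: x_def complex_eq_iff)
  obtain r where r: "r > 0" "ball (slice_embed I z) r \<subseteq> \<Omega>"
    using op z by (meson openE)
  have NA: "slice_embed J w \<in> \<Omega>" if "J \<in> imag_units" "w \<in> ball z r" for J w
  proof -
    have "slice_embed I z - slice_embed J w = slice_embed J (z - w)"
      by (simp add: zx slice_embed_real slice_embed_simps)
    then have "slice_embed J w \<in> ball (slice_embed I z) r"
      using that norm_slice_embed[OF that(1), of "z - w"] by (simp add: dist_norm)
    then show ?thesis
      using r by blast
  qed
  show ?thesis
    by (rule local_stem_tube[OF op f I, of "ball z r" x UNIV])
      (use r NA zx in \<open>auto intro!: that[of "ball z r" UNIV]\<close>)
next
  case False
  have op: "open \<Omega>" and real: "\<Omega> \<inter> \<real> \<noteq> {}" and conn: "connected (\<Omega> \<inter> slice_plane I)"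
    using \<Omega> I by (auto simp: slice_domain_def)
  define D where "D = slice_embed I -` \<Omega>"
  have D: "open D" "connected D"
    using open_slice[OF op] conn by (auto simp: D_def connected_slice[OF I])
  obtain x where x: "of_real x \<in> \<Omega>"
    using real by (auto elim: Reals_cases)
  then have "complex_of_real x \<in> D"
    by (simp add: D_def slice_embed_real)
  moreover have "z \<in> D"
    using z by (simp add: D_def)
  moreover have "path_connected D"
    using D connected_open_path_connected by blast
  ultimately obtain \<gamma> where \<gamma>: "path \<gamma>" "path_image \<gamma> \<subseteq> D" "pathstart \<gamma> = of_real x" "pathfinish \<gamma> = z"
    unfolding path_connected_def by metis
  have "compact (path_image \<gamma> \<times> {I})"
    using \<gamma> by (intro compact_Times compact_path_image) auto
  moreover have "open ((\<lambda>p. slice_embed (snd p) (fst p)) -` \<Omega>)"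
    by (rule open_vimage[OF op]) (intro continuous_intros)
  moreover have "path_image \<gamma> \<times> {I} \<subseteq> (\<lambda>p. slice_embed (snd p) (fst p)) -` \<Omega>"
    using \<gamma> by (auto simp: D_def)
  ultimately obtain e where e: "e > 0"
    "(\<Union>p\<in>path_image \<gamma> \<times> {I}. ball p e) \<subseteq> (\<lambda>p. slice_embed (snd p) (fst p)) -` \<Omega>"
    by (rule compact_subset_open_imp_ball_epsilon_subset)
  define N where "N = (\<lambda>(u, v). u + v) ` (path_image \<gamma> \<times> ball 0 (e / 2))"
  define A where "A = ball I (e / 2)"
  have pN: "p \<in> N" if "p \<in> path_image \<gamma>" for p
    using that e by (force simp: N_def)
  have "N = (\<Union>u\<in>path_image \<gamma>. \<Union>v\<in>ball 0 (e / 2). {u + v})"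
    by (auto simp: N_def)
  then have opN: "open N"
    by (simp only:) (rule open_sums, simp)
  have connN: "connected N"
    unfolding N_def case_prod_unfold
    by (intro connected_continuous_image continuous_intros connected_Times connected_path_image \<gamma>)
      simp
  have NA: "slice_embed J w \<in> \<Omega>" if JA: "J \<in> A" and wN: "w \<in> N" for J w
  proof -
    obtain u v where uv: "w = u + v" "u \<in> path_image \<gamma>" "norm v < e / 2"
      using wN by (auto simp: N_def)
    have "dist (u, I) (w, J) \<le> dist u w + dist I J"
      unfolding dist_Pair_Pair by (rule sqrt_sum_squares_le_sum) auto
    also have "\<dots> < e"
      using uv JA by (simp add: dist_norm A_def)
    finally have "(w, J) \<in> ball (u, I) e"
      by simp
    then have "(w, J) \<in> (\<lambda>p. slice_embed (snd p) (fst p)) -` \<Omega>"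
      using e(2) uv(2) by blast
    then show ?thesis
      by simp
  qed
  have xN: "complex_of_real x \<in> N" and zN: "z \<in> N"
    using pN \<gamma> by (metis pathstart_in_path_image, metis pathfinish_in_path_image)
  have A: "open A" "I \<in> A"
    using e by (auto simp: A_def)
  show ?thesis
    by (rule local_stem_tube[OF op f I opN connN xN A])
      (use NA zN opN A False in \<open>auto intro!: that[of N A]\<close>)
qed

section \<open>Spherical coefficients and the operations in terms of them\<close>

text \<open>
  On the sphere through \<open>slice_embed I z\<close>, the function \<open>f\<close> is given by
  \<open>b + J c\<close> for all imaginary units \<open>J\<close> near \<open>I\<close>.  The imaginary part of
  \<open>z\<close> may have any sign, or vanish.
\<close>

definition sphere_affine ::
    "quat set \<Rightarrow> (quat \<Rightarrow> quat) \<Rightarrow> quat \<Rightarrow> complex \<Rightarrow> quat \<Rightarrow> quat \<Rightarrow> bool"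
  where "sphere_affine \<Omega> f I z b c \<longleftrightarrow>
    (\<exists>A. open A \<and> I \<in> A \<and>
      (\<forall>J\<in>imag_units \<inter> A. slice_embed J z \<in> \<Omega> \<and> f (slice_embed J z) = b + J * c))"

lemma sphere_affineD:
  "sphere_affine \<Omega> f I z b c \<Longrightarrow> I \<in> imag_units \<Longrightarrow>
    slice_embed I z \<in> \<Omega> \<and> f (slice_embed I z) = b + I * c"
  by (auto simp: sphere_affine_def)

text \<open>Two different units already determine the coefficients.\<close>

lemma sphere_affine_unique:
  assumes I: "I \<in> imag_units"
    and 1: "sphere_affine \<Omega> f I z b c" and 2: "sphere_affine \<Omega>' f I z b' c'"
  shows "b = b' \<and> c = c'"
proof -
  obtain A where A: "open A" "I \<in> A" "\<forall>J\<in>imag_units \<inter> A. f (slice_embed J z) = b + J * c"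
    using 1 unfolding sphere_affine_def by blast
  obtain A' where A': "open A'" "I \<in> A'" "\<forall>J\<in>imag_units \<inter> A'. f (slice_embed J z) = b' + J * c'"
    using 2 unfolding sphere_affine_def by blast
  obtain J where J: "J \<in> imag_units" "J \<in> A \<inter> A'" "J \<noteq> I"
    using imag_unit_not_isolated[OF I, of "A \<inter> A'"] A A' by blast
  have "b + L * c = b' + L * c'" if "L \<in> imag_units" "L \<in> A" "L \<in> A'" for L
    using A(3) A'(3) that by (metis IntI)
  then have eI: "b + I * c = b' + I * c'" and eJ: "b + J * c = b' + J * c'"
    using A(2) A'(2) I J by blast+
  have "(J - I) * (c - c') = (b + J * c) - (b' + J * c') - ((b + I * c) - (b' + I * c'))"
    by (simp add: algebra_simps)
  then have "(J - I) * (c - c') = 0"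
    by (simp add: eI eJ)
  then have "c = c'"
    using J by simp
  then show ?thesis
    using eI by simp
qed

lemma sphere_affine_real:
  assumes I: "I \<in> imag_units" and aff: "sphere_affine \<Omega> f I z b c" and z: "Im z = 0"
  shows "c = 0" "f (slice_embed I z) = b"
proof -
  obtain A where "open A" "I \<in> A"
    "\<forall>J\<in>imag_units \<inter> A. slice_embed J z \<in> \<Omega> \<and> f (slice_embed J z) = b + J * c"
    using aff unfolding sphere_affine_def by blast
  \<comment> \<open>All units give the same point, so the constant value is another representation.\<close>
  then have "sphere_affine \<Omega> f I z (f (slice_embed I z)) 0"
    unfolding sphere_affine_def using z by (auto simp: slice_embed_real)
  then show "c = 0" "f (slice_embed I z) = b"
    using sphere_affine_unique[OF I aff] by auto
qed

lemma sphere_affine_transfer2: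
  assumes f: "sphere_affine \<Omega> f I z b c" and g: "sphere_affine \<Omega> g I z b' c'"
    and h: "\<And>J. J \<in> imag_units \<Longrightarrow> sphere_affine \<Omega> f J z b c \<Longrightarrow> sphere_affine \<Omega> g J z b' c' \<Longrightarrow>
      h (slice_embed J z) = b'' + J * c''"
  shows "sphere_affine \<Omega> h I z b'' c''"
proof -
  obtain A where A: "open A" "I \<in> A"
    "\<forall>J\<in>imag_units \<inter> A. slice_embed J z \<in> \<Omega> \<and> f (slice_embed J z) = b + J * c"
    using f unfolding sphere_affine_def by blast
  obtain A' where A': "open A'" "I \<in> A'"
    "\<forall>J\<in>imag_units \<inter> A'. slice_embed J z \<in> \<Omega> \<and> g (slice_embed J z) = b' + J * c'"
    using g unfolding sphere_affine_def by blast
  have "h (slice_embed J z) = b'' + J * c''" if "J \<in> imag_units" "J \<in> A \<inter> A'" for J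
  proof (rule h[OF that(1)])
    show "sphere_affine \<Omega> f J z b c"
      unfolding sphere_affine_def using A that by blast
    show "sphere_affine \<Omega> g J z b' c'"
      unfolding sphere_affine_def using A' that by blast
  qed
  then show ?thesis
    unfolding sphere_affine_def using A A' by (intro exI[of _ "A \<inter> A'"]) auto
qed

lemma sphere_affine_transfer:
  assumes f: "sphere_affine \<Omega> f I z b c"
    and h: "\<And>J. J \<in> imag_units \<Longrightarrow> sphere_affine \<Omega> f J z b c \<Longrightarrow>
      h (slice_embed J z) = b'' + J * c''"
  shows "sphere_affine \<Omega> h I z b'' c''"
  using sphere_affine_transfer2[OF f f] h by blast

lemma sphere_affine_subdomain:
  assumes f: "sphere_affine \<Omega> f I z b c" and \<Omega>': "open \<Omega>'" "slice_embed I z \<in> \<Omega>'"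
  shows "sphere_affine \<Omega>' f I z b c"
proof -
  obtain A where A: "open A" "I \<in> A" "\<forall>J\<in>imag_units \<inter> A. f (slice_embed J z) = b + J * c"
    using f unfolding sphere_affine_def by blast
  have "open ((\<lambda>J. slice_embed J z) -` \<Omega>')"
    by (rule open_vimage[OF \<Omega>'(1)]) (intro continuous_intros)
  then show ?thesis
    unfolding sphere_affine_def using A \<Omega>'
    by (intro exI[of _ "A \<inter> (\<lambda>J. slice_embed J z) -` \<Omega>'"]) auto
qed

text \<open>
  The sign enters because the spherical coefficients refer to the representation
  \<open>x + y J\<close> with \<open>y > 0\<close>.
\<close>

lemma spherical_coeffs_eq:
  assumes I: "I \<in> imag_units" and aff: "sphere_affine \<Omega> f I z b c" and z: "Im z \<noteq> 0"
  shows "spherical_coeffs \<Omega> f (slice_embed I z) = (b, sgn (Im z) *\<^sub>R c)"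
proof -
  define s where "s = sgn (Im z)"
  define x where "x = Re z"
  define y where "y = \<bar>Im z\<bar>"
  have s: "s * s = 1" "s = 1 \<or> s = - 1" and y: "y > 0" and sy: "s * y = Im z"
    using z by (auto simp: s_def y_def sgn_if)
  have ss: "s *\<^sub>R s *\<^sub>R q = q" for q :: quat
    by (simp add: s)
  have ys: "Im z * s = y"
    using sy s(2) by auto
  have s_unit: "s *\<^sub>R J \<in> imag_units" if "J \<in> imag_units" for J
    using s(2) that imag_unit_minus by auto
  have pt: "slice_pt J x y = slice_embed (s *\<^sub>R J) z" for J
    by (simp add: slice_pt_eq_embed slice_embed_eq x_def ys)
  define S where "S = sphere_through (slice_embed I z)"
  have S: "S = {slice_pt J x y | J. J \<in> imag_units}"
    by (simp add: S_def sphere_through_def qre_slice_embed[OF I] norm_qim_slice_embed[OF I] x_def y_def)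
  have coeffs: "spherical_coeffs \<Omega> f (slice_embed I z) = (THE (b, c).
      \<exists>U. U \<subseteq> \<Omega> \<and> openin (top_of_set S) U \<and> slice_embed I z \<in> U \<and>
        (\<forall>J\<in>imag_units. slice_pt J x y \<in> U \<longrightarrow> f (slice_pt J x y) = b + J * c))"
    by (simp add: spherical_coeffs_def S_def qre_slice_embed[OF I] norm_qim_slice_embed[OF I] x_def y_def)
  have "spherical_coeffs \<Omega> f (slice_embed I z) = (b, s *\<^sub>R c)"
    unfolding coeffs
  proof (rule the_equality, goal_cases)
    case 1
    obtain A where A: "open A" "I \<in> A"
      "\<And>J. J \<in> imag_units \<Longrightarrow> J \<in> A \<Longrightarrow> slice_embed J z \<in> \<Omega> \<and> f (slice_embed J z) = b + J * c"
      using aff unfolding sphere_affine_def by blast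
    define T where "T = (\<lambda>q. (s / y) *\<^sub>R (q - of_real x)) -` A"
    have "open T"
      unfolding T_def by (rule open_vimage[OF A(1)]) (intro continuous_intros)
    have T: "slice_embed J z \<in> T \<longleftrightarrow> J \<in> A" for J
    proof -
      have "(s / y) *\<^sub>R (slice_embed J z - of_real x) = (s * Im z / y) *\<^sub>R J"
        by (simp add: slice_embed_eq x_def of_real_def)
      also have "s * Im z / y = 1"
        using ys y by (simp add: mult.commute)
      finally show ?thesis
        by (simp add: T_def)
    qed
    show ?case
      unfolding prod.case
    proof (intro exI[of _ "S \<inter> T"] conjI ballI impI)
      show "S \<inter> T \<subseteq> \<Omega>"
        using A(3) s_unit by (auto simp: S pt T)
      show "openin (top_of_set S) (S \<inter> T)"
        using \<open>open T\<close> by blast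
      have "slice_embed I z = slice_pt (s *\<^sub>R I) x y"
        by (simp add: pt s(1))
      then have "slice_embed I z \<in> S"
        using s_unit[OF I] by (auto simp: S)
      then show "slice_embed I z \<in> S \<inter> T"
        using T A(2) by blast
      show "f (slice_pt J x y) = b + J * s *\<^sub>R c" if "J \<in> imag_units" "slice_pt J x y \<in> S \<inter> T" for J
        using A(3)[OF s_unit[OF that(1)]] that(2) by (simp add: pt T)
    qed
  next
    case (2 bc)
    obtain b' c' where bc: "bc = (b', c')"
      by fastforce
    obtain U where U: "U \<subseteq> \<Omega>" "openin (top_of_set S) U" "slice_embed I z \<in> U"
      "\<And>J. J \<in> imag_units \<Longrightarrow> slice_pt J x y \<in> U \<Longrightarrow> f (slice_pt J x y) = b' + J * c'"
      using 2 unfolding bc prod.case by blast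
    obtain T where T: "open T" "U = S \<inter> T"
      using U(2) by (auto simp: openin_open)
    have "sphere_affine \<Omega> f I z b' (s *\<^sub>R c')"
      unfolding sphere_affine_def
    proof (intro exI[of _ "(\<lambda>J. slice_embed J z) -` T"] conjI ballI)
      show "open ((\<lambda>J. slice_embed J z) -` T)"
        by (rule open_vimage[OF T(1)]) (intro continuous_intros)
      fix J assume J: "J \<in> imag_units \<inter> (\<lambda>J. slice_embed J z) -` T"
      have eq: "slice_embed J z = slice_pt (s *\<^sub>R J) x y"
        by (simp add: pt s(1))
      then have "slice_pt (s *\<^sub>R J) x y \<in> U"
        using J s_unit T(2) by (auto simp: S)
      then show "slice_embed J z \<in> \<Omega>" "f (slice_embed J z) = b' + J * s *\<^sub>R c'"
        using U(1) U(4)[of "s *\<^sub>R J"] s_unit J by (auto simp: eq)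
    qed (use U T in auto)
    then have "b' = b" "s *\<^sub>R c' = c"
      using sphere_affine_unique[OF I aff] by auto
    then show ?case
      using ss[of c'] by (simp add: bc)
  qed
  then show ?thesis
    by (simp add: s_def)
qed

lemma sph_value_eq:
  assumes "I \<in> imag_units" "sphere_affine \<Omega> f I z b c"
  shows "sph_value \<Omega> f (slice_embed I z) = b"
  using spherical_coeffs_eq[OF assms] sphere_affine_real[OF assms]
  by (auto simp: sph_value_def slice_embed_in_Reals_iff[OF assms(1)])

lemma sph_deriv_eq:
  assumes "I \<in> imag_units" "sphere_affine \<Omega> f I z b c" "Im z \<noteq> 0"
  shows "sph_deriv \<Omega> f (slice_embed I z) = c /\<^sub>R Im z"
  using assms(3) spherical_coeffs_eq[OF assms]
  by (auto simp: sph_deriv_def norm_qim_slice_embed[OF assms(1)] sgn_if)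

lemma regular_conj_eq:
  assumes "I \<in> imag_units" "sphere_affine \<Omega> f I z b c"
  shows "regular_conj \<Omega> f (slice_embed I z) = qcnj b + I * qcnj c"
proof (cases "Im z = 0")
  case True
  then show ?thesis
    using sphere_affine_real[OF assms] assms(1)
    by (simp add: regular_conj_def slice_embed_in_Reals_iff quat_eq_iff)
next
  case False
  then have "Im z *\<^sub>R I * qcnj (c /\<^sub>R Im z) = I * qcnj c"
    by (simp add: quat_eq_iff field_simps)
  then show ?thesis
    using False assms(1)
    by (simp add: regular_conj_def slice_embed_in_Reals_iff sph_value_eq[OF assms] sph_deriv_eq[OF assms]
        qim_slice_embed)
qed

lemma regular_prod_eq:
  assumes "I \<in> imag_units" "sphere_affine \<Omega> f I z b c" "sphere_affine \<Omega> g I z b' c'"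
  shows "regular_prod \<Omega> f g (slice_embed I z) = (b * b' - c * c') + I * (b * c' + c * b')"
proof (cases "Im z = 0")
  case True
  then show ?thesis
    using sphere_affine_real[OF assms(1,2)] sphere_affine_real[OF assms(1,3)] assms(1)
    by (simp add: regular_prod_def slice_embed_in_Reals_iff)
next
  case False
  have "(Im z *\<^sub>R I)\<^sup>2 = - ((Im z)\<^sup>2 *\<^sub>R 1)"
    by (simp add: power2_eq_square imag_unit_sq[OF assms(1)])
  moreover have "inverse (Im z) * (inverse (Im z) * (Im z * Im z)) = 1"
    using False by (simp add: field_simps)
  ultimately show ?thesis
    using False assms(1)
    by (simp add: regular_prod_def slice_embed_in_Reals_iff sph_value_eq[OF assms(1,2)]
        sph_value_eq[OF assms(1,3)] sph_deriv_eq[OF assms(1,2)] sph_deriv_eq[OF assms(1,3)]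
        qim_slice_embed distrib_left power2_eq_square)
qed

text \<open>
  The product of \<open>b + \<iota> c\<close> with its conjugate lies in the centre of the complexified
  quaternions, which is the field of complex numbers.
\<close>

definition stem_sym :: "quat \<Rightarrow> quat \<Rightarrow> complex"
  where "stem_sym b c = Complex ((norm b)\<^sup>2 - (norm c)\<^sup>2) (2 * (b \<bullet> c))"

lemma qcnj_0 [simp]: "qcnj 0 = 0"
  by (simp add: quat_eq_iff)

lemma qre_mult_qcnj: "qre (b * qcnj c) = b \<bullet> c"
  by (simp add: inner_quat_def)

lemma symmetrization_eq:
  assumes "I \<in> imag_units" "sphere_affine \<Omega> f I z b c"
  shows "symmetrization \<Omega> f (slice_embed I z) = slice_embed I (stem_sym b c)"
proof (cases "Im z = 0")
  case True
  then show ?thesis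
    using sphere_affine_real[OF assms] assms(1)
    by (simp add: symmetrization_def slice_embed_in_Reals_iff slice_embed_eq stem_sym_def
        scaleR_conv_of_real)
next
  case False
  have re: "qre (b * qcnj (c /\<^sub>R Im z)) = (b \<bullet> c) / Im z"
    by (simp only: qre_mult_qcnj inner_scaleR_right divide_inverse mult.commute)
  have nrm: "norm (Im z *\<^sub>R I * (c /\<^sub>R Im z)) = norm c"
    using False by (simp add: norm_mult imag_unit_norm[OF assms(1)])
  have im: "2 * (Im z *\<^sub>R I) * of_real ((b \<bullet> c) / Im z) = (2 * (b \<bullet> c)) *\<^sub>R I"
    using False unfolding mult_2 by (simp add: quat_eq_iff field_simps del: of_real_divide)
  have "symmetrization \<Omega> f (slice_embed I z)
      = of_real ((norm b)\<^sup>2) - of_real ((norm c)\<^sup>2) + (2 * (b \<bullet> c)) *\<^sub>R I"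
    unfolding symmetrization_def
    by (simp only: slice_embed_in_Reals_iff[OF assms(1)] False if_False sph_value_eq[OF assms]
        sph_deriv_eq[OF assms False] qim_slice_embed[OF assms(1)] re nrm im)
  also have "\<dots> = slice_embed I (stem_sym b c)"
    by (simp only: slice_embed_eq stem_sym_def complex.sel flip: of_real_diff)
      (simp only: scaleR_conv_of_real mult_1_right)
  finally show ?thesis .
qed

lemma recip_coeff_scaleR:
  assumes "s * s = 1"
  shows "recip_coeff b (s *\<^sub>R c) = recip_coeff b c"
    and "recip_coeff (s *\<^sub>R c) b = s *\<^sub>R recip_coeff c b"
proof -
  have qc: "qcnj (s *\<^sub>R c) = s *\<^sub>R qcnj c"
    by (simp add: quat_eq_iff)
  have "s = 1 \<or> s = - 1"
    using assms by (metis square_eq_1_iff power2_eq_square)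
  then show "recip_coeff b (s *\<^sub>R c) = recip_coeff b c"
    and "recip_coeff (s *\<^sub>R c) b = s *\<^sub>R recip_coeff c b"
    unfolding recip_coeff_def qre_mult_qcnj unfolding qc by (auto simp: algebra_simps)
qed

lemma regular_recip_eq:
  assumes "I \<in> imag_units" "sphere_affine \<Omega> f I z b c"
  shows "regular_recip \<Omega> f (slice_embed I z) = recip_coeff b c + I * (- recip_coeff c b)"
proof (cases "Im z = 0")
  case True
  have "recip_coeff b 0 = ((norm b)\<^sup>2 *\<^sub>R qcnj b) /\<^sub>R ((norm b)\<^sup>2)\<^sup>2"
    unfolding recip_coeff_def qre_mult_qcnj by (simp add: scaleR_conv_of_real)
  also have "\<dots> = inverse b"
    by (cases "b = 0") (simp_all add: inverse_quat_def power2_eq_square field_simps)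
  finally have "inverse b = recip_coeff b 0"
    by simp
  moreover have "recip_coeff 0 b = 0"
    by (simp add: recip_coeff_def)
  ultimately show ?thesis
    using True sphere_affine_real[OF assms] assms(1)
    by (simp add: regular_recip_def slice_embed_in_Reals_iff)
next
  case False
  define s where "s = sgn (Im z)"
  have s: "s * s = 1"
    using False by (simp add: s_def sgn_if)
  have c: "\<bar>Im z\<bar> *\<^sub>R (c /\<^sub>R Im z) = s *\<^sub>R c" and I: "(Im z *\<^sub>R I) /\<^sub>R \<bar>Im z\<bar> = s *\<^sub>R I"
    using False by (simp_all add: s_def sgn_if)
  have nI: "norm (Im z *\<^sub>R I) = \<bar>Im z\<bar>"
    by (simp add: imag_unit_norm[OF assms(1)])
  have "regular_recip \<Omega> f (slice_embed I z)
      = recip_coeff b (s *\<^sub>R c) - (s *\<^sub>R I) * recip_coeff (s *\<^sub>R c) b"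
    unfolding regular_recip_def
    by (simp only: slice_embed_in_Reals_iff[OF assms(1)] False if_False sph_value_eq[OF assms]
        sph_deriv_eq[OF assms False] qim_slice_embed[OF assms(1)] nI c I)
  then show ?thesis
    by (simp add: recip_coeff_scaleR[OF s] s)
qed

section \<open>Algebra of the reciprocal coefficients\<close>

lemma qcnj_mult_add: "b * qcnj c + c * qcnj b = of_real (2 * (b \<bullet> c))"
    "qcnj b * c + qcnj c * b = of_real (2 * (b \<bullet> c))"
  by (simp_all add: quat_eq_iff inner_quat_def algebra_simps del: of_real_mult of_real_add)

lemma recip_coeff_eq:
  fixes b c :: quat
  defines "\<phi> \<equiv> stem_sym b c"
  shows "recip_coeff b c = (Re \<phi> *\<^sub>R qcnj b + Im \<phi> *\<^sub>R qcnj c) /\<^sub>R (cmod \<phi>)\<^sup>2"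
    and "- recip_coeff c b = (Re \<phi> *\<^sub>R qcnj c - Im \<phi> *\<^sub>R qcnj b) /\<^sub>R (cmod \<phi>)\<^sup>2"
proof -
  have gen: "of_real ((norm b)\<^sup>2) * qcnj b + qcnj c * b * qcnj c
      = ((norm b)\<^sup>2 - (norm c)\<^sup>2) *\<^sub>R qcnj b + (2 * (b \<bullet> c)) *\<^sub>R qcnj c" for b c
  proof -
    have "qcnj c * b * qcnj c + qcnj b * (c * qcnj c) = (qcnj b * c + qcnj c * b) * qcnj c"
      by (simp add: algebra_simps)
    then show ?thesis
      unfolding qcnj_mult_add mult_qcnj of_real_def by (simp add: algebra_simps)
  qed
  have N: "((norm b)\<^sup>2 - (norm c)\<^sup>2)\<^sup>2 + (2 * (b \<bullet> c))\<^sup>2 = (cmod \<phi>)\<^sup>2"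
    by (simp add: \<phi>_def stem_sym_def cmod_power2)
  show "recip_coeff b c = (Re \<phi> *\<^sub>R qcnj b + Im \<phi> *\<^sub>R qcnj c) /\<^sub>R (cmod \<phi>)\<^sup>2"
    unfolding recip_coeff_def gen qre_mult_qcnj N by (simp add: \<phi>_def stem_sym_def)
  have N': "((norm c)\<^sup>2 - (norm b)\<^sup>2)\<^sup>2 + (2 * (c \<bullet> b))\<^sup>2 = (cmod \<phi>)\<^sup>2"
    unfolding N[symmetric] by (simp add: power2_commute inner_commute)
  show "- recip_coeff c b = (Re \<phi> *\<^sub>R qcnj c - Im \<phi> *\<^sub>R qcnj b) /\<^sub>R (cmod \<phi>)\<^sup>2"
    unfolding recip_coeff_def gen qre_mult_qcnj N'
    by (simp add: \<phi>_def stem_sym_def inner_commute algebra_simps)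
qed

text \<open>In the complexified quaternions the reciprocal stem is a two-sided inverse.\<close>

lemma recip_coeff_inverse:
  assumes "stem_sym b c \<noteq> 0"
  defines "p \<equiv> recip_coeff b c" and "q \<equiv> - recip_coeff c b"
  shows "b * p - c * q = 1" "b * q + c * p = 0" "p * b - q * c = 1" "p * c + q * b = 0"
proof -
  define \<beta> where "\<beta> = Re (stem_sym b c)"
  define \<gamma> where "\<gamma> = Im (stem_sym b c)"
  define N where "N = (cmod (stem_sym b c))\<^sup>2"
  have "N \<noteq> 0"
    using assms(1) by (simp add: N_def)
  moreover have "N = \<beta> * \<beta> + \<gamma> * \<gamma>"
    unfolding N_def \<beta>_def \<gamma>_def cmod_power2 by (simp only: power2_eq_square)
  ultimately have N: "N = \<beta> * \<beta> + \<gamma> * \<gamma>" "N \<noteq> 0"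
    by auto
  have p: "p = (\<beta> *\<^sub>R qcnj b + \<gamma> *\<^sub>R qcnj c) /\<^sub>R N" and q: "q = (\<beta> *\<^sub>R qcnj c - \<gamma> *\<^sub>R qcnj b) /\<^sub>R N"
    unfolding p_def q_def \<beta>_def \<gamma>_def N_def by (rule recip_coeff_eq)+
  have \<beta>: "b * qcnj b - c * qcnj c = \<beta> *\<^sub>R 1" "qcnj b * b - qcnj c * c = \<beta> *\<^sub>R 1"
    by (simp_all add: mult_qcnj \<beta>_def stem_sym_def scaleR_conv_of_real)
  have \<gamma>: "b * qcnj c + c * qcnj b = \<gamma> *\<^sub>R 1" "qcnj b * c + qcnj c * b = \<gamma> *\<^sub>R 1"
    unfolding qcnj_mult_add by (simp_all add: \<gamma>_def stem_sym_def scaleR_conv_of_real)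
  have one: "(\<beta> *\<^sub>R \<beta> *\<^sub>R 1 + \<gamma> *\<^sub>R \<gamma> *\<^sub>R 1) /\<^sub>R N = (1 :: quat)"
    using N(2) by (simp flip: scaleR_add_left N(1))
  have "b * p - c * q = (\<beta> *\<^sub>R (b * qcnj b - c * qcnj c) + \<gamma> *\<^sub>R (b * qcnj c + c * qcnj b)) /\<^sub>R N"
    by (simp add: p q algebra_simps)
  then show "b * p - c * q = 1"
    unfolding \<beta> \<gamma> one .
  have "p * b - q * c = (\<beta> *\<^sub>R (qcnj b * b - qcnj c * c) + \<gamma> *\<^sub>R (qcnj b * c + qcnj c * b)) /\<^sub>R N"
    by (simp add: p q algebra_simps)
  then show "p * b - q * c = 1"
    unfolding \<beta> \<gamma> one .
  have "b * q + c * p = (\<beta> *\<^sub>R (b * qcnj c + c * qcnj b) - \<gamma> *\<^sub>R (b * qcnj b - c * qcnj c)) /\<^sub>R N"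
    by (simp add: p q algebra_simps)
  then show "b * q + c * p = 0"
    unfolding \<beta> \<gamma> by (simp add: mult.commute)
  have "p * c + q * b = (\<beta> *\<^sub>R (qcnj b * c + qcnj c * b) - \<gamma> *\<^sub>R (qcnj b * b - qcnj c * c)) /\<^sub>R N"
    by (simp add: p q algebra_simps)
  then show "p * c + q * b = 0"
    unfolding \<beta> \<gamma> by (simp add: mult.commute)
qed

text \<open>
  In the complexified quaternions the reciprocal is the conjugate divided by \<open>stem_sym\<close>.
  If \<open>stem_sym b c = 0\<close>, both sides are \<open>0\<close>.
\<close>

lemma recip_coeff_conj:
  assumes I: "I \<in> imag_units"
  shows "recip_coeff b c + I * (- recip_coeff c b)
    = slice_embed I (inverse (stem_sym b c)) * (qcnj b + I * qcnj c)"
proof -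
  define \<phi> where "\<phi> = stem_sym b c"
  have inv: "slice_embed I (inverse \<phi>) = (Re \<phi> *\<^sub>R 1 - Im \<phi> *\<^sub>R I) /\<^sub>R (cmod \<phi>)\<^sup>2"
    by (simp add: slice_embed_eq cmod_power2 divide_inverse algebra_simps)
  show ?thesis
    unfolding recip_coeff_eq(2)[where b = b and c = c] recip_coeff_eq(1)[where b = b and c = c]
      \<phi>_def[symmetric] inv
    by (simp add: algebra_simps imag_unit_sq_mult[OF I])
qed

lemma stem_sym_of_real: "stem_sym (of_real (Re \<phi>)) (of_real (Im \<phi>)) = \<phi>\<^sup>2"
  by (simp add: stem_sym_def complex_eq_iff power2_eq_square inner_quat_def)

lemma recip_coeff_of_real:
  "recip_coeff (of_real (Re \<phi>)) (of_real (Im \<phi>)) = of_real (Re (inverse \<phi>))"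
  "- recip_coeff (of_real (Im \<phi>)) (of_real (Re \<phi>)) = of_real (Im (inverse \<phi>))"
proof -
  have qc: "qcnj (of_real r) = of_real r" for r
    by (simp add: quat_eq_iff)
  define n where "n = (Re \<phi>)\<^sup>2 + (Im \<phi>)\<^sup>2"
  have N: "(cmod (\<phi>\<^sup>2))\<^sup>2 = n * n"
    unfolding norm_power cmod_power2[of \<phi>] n_def by (rule power2_eq_square)
  have r1: "Re (\<phi>\<^sup>2) * Re \<phi> + Im (\<phi>\<^sup>2) * Im \<phi> = n * Re \<phi>"
    and r2: "Re (\<phi>\<^sup>2) * Im \<phi> - Im (\<phi>\<^sup>2) * Re \<phi> = - (n * Im \<phi>)"
    by (simp_all add: n_def power2_eq_square algebra_simps)
  have inv: "Re (inverse \<phi>) = Re \<phi> / n" "Im (inverse \<phi>) = - Im \<phi> / n"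
    by (simp_all add: n_def)
  have lin: "(Re (\<phi>\<^sup>2) *\<^sub>R of_real (Re \<phi>) + Im (\<phi>\<^sup>2) *\<^sub>R of_real (Im \<phi>) :: quat) = of_real (n * Re \<phi>)"
      "(Re (\<phi>\<^sup>2) *\<^sub>R of_real (Im \<phi>) - Im (\<phi>\<^sup>2) *\<^sub>R of_real (Re \<phi>) :: quat) = of_real (- (n * Im \<phi>))"
    unfolding r1[symmetric] r2[symmetric] by (simp_all only: scaleR_conv_of_real of_real_mult of_real_add of_real_diff)
  have cancel: "of_real (n * r) /\<^sub>R (n * n) = (of_real (r / n) :: quat)" for r
    by (cases "n = 0") (simp_all add: quat_eq_iff field_simps del: of_real_mult of_real_divide)
  show "recip_coeff (of_real (Re \<phi>)) (of_real (Im \<phi>)) = of_real (Re (inverse \<phi>))"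
    unfolding recip_coeff_eq(1) stem_sym_of_real qc N inv lin by (rule cancel)
  show "- recip_coeff (of_real (Im \<phi>)) (of_real (Re \<phi>)) = of_real (Im (inverse \<phi>))"
    unfolding recip_coeff_eq(2) stem_sym_of_real qc N inv lin
    using cancel[of "- Im \<phi>"] by simp
qed

section \<open>The symmetrization and its zero set\<close>

lemma local_affine_stem:
  assumes \<Omega>: "slice_domain \<Omega>" and f: "slice_regular_on \<Omega> f" and I: "I \<in> imag_units"
    and z: "slice_embed I z \<in> \<Omega>"
  obtains N A b c where "open N" "z \<in> N" "open A" "I \<in> A" "Im z = 0 \<Longrightarrow> A = UNIV"
    "stem_holomorphic N b c"
    "\<And>J w. J \<in> imag_units \<Longrightarrow> J \<in> A \<Longrightarrow> w \<in> N \<Longrightarrow> sphere_affine \<Omega> f J w (b w) (c w)"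
proof -
  obtain N A b c where N: "open N" "z \<in> N" and A: "open A" "I \<in> A" "Im z = 0 \<Longrightarrow> A = UNIV"
    and stem: "stem_holomorphic N b c"
    and rep: "\<And>J w. J \<in> imag_units \<Longrightarrow> J \<in> A \<Longrightarrow> w \<in> N \<Longrightarrow> slice_embed J w \<in> \<Omega>"
      "\<And>J w. J \<in> imag_units \<Longrightarrow> J \<in> A \<Longrightarrow> w \<in> N \<Longrightarrow> f (slice_embed J w) = b w + J * c w"
    by (rule local_stem[OF \<Omega> f I z]) blast
  have "sphere_affine \<Omega> f J w (b w) (c w)" if "J \<in> imag_units" "J \<in> A" "w \<in> N" for J w
    unfolding sphere_affine_def using A(1) rep that by blast
  then show ?thesis
    using that[of N A b c] N A stem by blast
qed

lemma sphere_affine_exists: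
  assumes \<Omega>: "slice_domain \<Omega>" and f: "slice_regular_on \<Omega> f" and I: "I \<in> imag_units"
    and z: "slice_embed I z \<in> \<Omega>"
  obtains b c where "sphere_affine \<Omega> f I z b c"
  by (rule local_affine_stem[OF \<Omega> f I z]) (use I that in blast)

lemma stem_sym_holomorphic:
  assumes "stem_holomorphic N b c"
  shows "(\<lambda>w. stem_sym (b w) (c w)) holomorphic_on N"
proof -
  define F where "F v w = Complex (b w \<bullet> v) (c w \<bullet> v)" for v w
  have F: "F v holomorphic_on N" for v
    using assms unfolding stem_holomorphic_def F_def by blast
  have "stem_sym (b w) (c w) = (F (Quat 1 0 0 0) w)\<^sup>2 + (F (Quat 0 1 0 0) w)\<^sup>2
      + (F (Quat 0 0 1 0) w)\<^sup>2 + (F (Quat 0 0 0 1) w)\<^sup>2" for w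
    unfolding stem_sym_def norm_quat_power2
    by (simp add: F_def complex_eq_iff inner_quat_def power2_eq_square)
  then show ?thesis
    by (simp add: holomorphic_intros F)
qed

lemma stem_conj_holomorphic:
  assumes "stem_holomorphic N b c"
  shows "stem_holomorphic N (\<lambda>w. qcnj (b w)) (\<lambda>w. qcnj (c w))"
proof -
  have "qcnj p \<bullet> v = p \<bullet> qcnj v" for p v
    by (simp add: inner_quat_def)
  then show ?thesis
    using assms by (simp add: stem_holomorphic_def)
qed

text \<open>On each slice the symmetrization is a holomorphic function into that slice.\<close>

lemma symmetrization_holomorphic:
  assumes \<Omega>: "slice_domain \<Omega>" and f: "slice_regular_on \<Omega> f" and I: "I \<in> imag_units"
  obtains \<phi> where "\<phi> holomorphic_on slice_embed I -` \<Omega>"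
    "\<And>z. slice_embed I z \<in> \<Omega> \<Longrightarrow> symmetrization \<Omega> f (slice_embed I z) = slice_embed I (\<phi> z)"
proof -
  define \<phi> where "\<phi> z = slice_coord I (symmetrization \<Omega> f (slice_embed I z))" for z
  have eq: "symmetrization \<Omega> f (slice_embed I z) = slice_embed I (\<phi> z)"
    if "slice_embed I z \<in> \<Omega>" for z
  proof -
    obtain b c where "sphere_affine \<Omega> f I z b c"
      by (rule sphere_affine_exists[OF \<Omega> f I \<open>slice_embed I z \<in> \<Omega>\<close>])
    then show ?thesis
      by (simp add: \<phi>_def symmetrization_eq[OF I] slice_coord_embed[OF I])
  qed
  have op: "open (slice_embed I -` \<Omega>)"
    using \<Omega> by (intro open_slice) (simp add: slice_domain_def)
  have "\<exists>D. (\<phi> has_field_derivative D) (at z)" if z: "slice_embed I z \<in> \<Omega>" for z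
  proof (rule local_affine_stem[OF \<Omega> f I z])
    fix N A b c
    assume N: "open N" "z \<in> N" and A: "I \<in> A" and stem: "stem_holomorphic N b c"
      and aff: "\<And>J w. J \<in> imag_units \<Longrightarrow> J \<in> A \<Longrightarrow> w \<in> N \<Longrightarrow> sphere_affine \<Omega> f J w (b w) (c w)"
    have "\<phi> holomorphic_on N"
      by (rule holomorphic_transform[OF stem_sym_holomorphic[OF stem]])
        (simp add: \<phi>_def symmetrization_eq[OF I aff[OF I A]] slice_coord_embed[OF I])
    then show ?thesis
      using N by (auto simp: holomorphic_on_open)
  qed
  then have "\<phi> holomorphic_on slice_embed I -` \<Omega>"
    using op by (auto simp: holomorphic_on_open)
  then show ?thesis
    using eq that by blast
qed

lemma slice_connected:
  "slice_domain \<Omega> \<Longrightarrow> I \<in> imag_units \<Longrightarrow> connected (slice_embed I -` \<Omega>)"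
  by (auto simp: slice_domain_def simp flip: connected_slice)

lemma slice_domain_real_point:
  assumes "slice_domain \<Omega>"
  obtains x where "(of_real x :: quat) \<in> \<Omega>"
  using assms by (auto simp: slice_domain_def elim: Reals_cases)

lemma slice_regular_identity:
  assumes \<Omega>: "slice_domain \<Omega>" and f: "slice_regular_on \<Omega> f" and g: "slice_regular_on \<Omega> g"
    and eq: "\<And>x. of_real x \<in> \<Omega> \<Longrightarrow> f (of_real x) = g (of_real x)" and q: "q \<in> \<Omega>"
  shows "f q = g q"
proof -
  have op: "open \<Omega>"
    using \<Omega> by (simp add: slice_domain_def)
  obtain I z where I: "I \<in> imag_units" and z: "q = slice_embed I z"
    using exists_slice by blast
  obtain x where x: "of_real x \<in> \<Omega>"
    by (rule slice_domain_real_point[OF \<Omega>])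
  have "f (slice_embed I z) - g (slice_embed I z) = 0"
  proof (rule slice_diff_identity[OF I open_slice[OF op] slice_connected[OF \<Omega> I], where x = x])
    show "slice_diff I (\<lambda>w. f (slice_embed I w) - g (slice_embed I w)) w"
      if "w \<in> slice_embed I -` \<Omega>" for w
      using that by (intro slice_diff_diff slice_regular_imp_slice_diff[OF op _ I] f g) auto
  qed (use x q z eq in \<open>auto simp: slice_embed_real\<close>)
  then show ?thesis
    by (simp add: z)
qed

lemma slice_regular_conj:
  assumes \<Omega>: "slice_domain \<Omega>" and f: "slice_regular_on \<Omega> f"
  shows "slice_regular_on \<Omega> (regular_conj \<Omega> f)"
proof (rule slice_diff_imp_slice_regular)
  show "open \<Omega>"
    using \<Omega> by (simp add: slice_domain_def)
  fix I z assume I: "I \<in> imag_units" and z: "slice_embed I z \<in> \<Omega>"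
  show "slice_diff I (\<lambda>w. regular_conj \<Omega> f (slice_embed I w)) z"
  proof (rule local_affine_stem[OF \<Omega> f I z])
    fix N A b c
    assume N: "open N" "z \<in> N" and A: "I \<in> A" and stem: "stem_holomorphic N b c"
      and aff: "\<And>J w. J \<in> imag_units \<Longrightarrow> J \<in> A \<Longrightarrow> w \<in> N \<Longrightarrow> sphere_affine \<Omega> f J w (b w) (c w)"
    show ?thesis
      by (rule slice_diff_cong_open[OF stem_slice_diff[OF I N stem_conj_holomorphic[OF stem]] N])
        (simp add: regular_conj_eq[OF I aff[OF I A]])
  qed
qed

lemma continuous_qim: "continuous_on S qim"
proof -
  have eq: "qim = (\<lambda>q. q - (q \<bullet> 1) *\<^sub>R 1)"
    by (simp add: fun_eq_iff qim_def inner_quat_def of_real_def)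
  show ?thesis
    unfolding eq by (intro continuous_intros)
qed

lemma continuous_half_coord: "continuous_on S half_coord"
proof -
  have eq: "half_coord = (\<lambda>q. of_real (q \<bullet> 1) + \<i> * of_real (norm (qim q)))"
    by (simp add: fun_eq_iff half_coord_def inner_quat_def Complex_eq)
  show ?thesis
    unfolding eq by (intro continuous_intros continuous_qim)
qed

lemma half_coord_slice_embed: "I \<in> imag_units \<Longrightarrow> 0 \<le> Im z \<Longrightarrow> half_coord (slice_embed I z) = z"
  by (simp add: half_coord_def qre_slice_embed norm_qim_slice_embed complex_eq_iff)

lemma unit_of_slice_embed: "I \<in> imag_units \<Longrightarrow> 0 < Im z \<Longrightarrow> unit_of (slice_embed I z) = I"
  by (simp add: unit_of_def qim_slice_embed imag_unit_norm)

text \<open>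
  Near \<open>x + y I\<close> the symmetrization vanishes where the complex function
  \<open>stem_sym\<close> does, whatever the unit; the units allowed are all those near \<open>I\<close>, or
  all units if the point is real, where \<open>unit_of\<close> is not continuous.
\<close>

lemma open_recip_domain:
  assumes \<Omega>: "slice_domain \<Omega>" and f: "slice_regular_on \<Omega> f"
  shows "open (recip_domain \<Omega> f)"
proof (subst open_subopen, intro ballI)
  fix q assume q: "q \<in> recip_domain \<Omega> f"
  have op: "open \<Omega>"
    using \<Omega> by (simp add: slice_domain_def)
  have mem: "p \<in> recip_domain \<Omega> f \<longleftrightarrow> p \<in> \<Omega> \<and> symmetrization \<Omega> f p \<noteq> 0" for p
    by (auto simp: recip_domain_def zero_set_def)
  obtain I z where I: "I \<in> imag_units" and qz: "q = slice_embed I z" "0 \<le> Im z"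
    using exists_slice by blast
  have z: "slice_embed I z \<in> \<Omega>"
    using q by (simp add: mem qz)
  show "\<exists>T. open T \<and> q \<in> T \<and> T \<subseteq> recip_domain \<Omega> f"
  proof (rule local_affine_stem[OF \<Omega> f I z])
    fix N A b c
    assume N: "open N" "z \<in> N" and A: "open A" "I \<in> A" "Im z = 0 \<Longrightarrow> A = UNIV"
      and stem: "stem_holomorphic N b c"
      and aff: "\<And>J w. J \<in> imag_units \<Longrightarrow> J \<in> A \<Longrightarrow> w \<in> N \<Longrightarrow> sphere_affine \<Omega> f J w (b w) (c w)"
    define N' where "N' = N \<inter> (\<lambda>w. stem_sym (b w) (c w)) -` (- {0})"
    have opN': "open N'"
      unfolding N'_def
      by (rule continuous_open_preimage[OF holomorphic_on_imp_continuous_on[OF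
            stem_sym_holomorphic[OF stem]] N(1)]) auto
    have sym: "symmetrization \<Omega> f (slice_embed J w) = slice_embed J (stem_sym (b w) (c w))"
      if "J \<in> imag_units" "J \<in> A" "w \<in> N" for J w
      using symmetrization_eq[OF that(1) aff[OF that]] .
    have zN': "z \<in> N'"
      using q N sym[OF I A(2) N(2)] by (auto simp: N'_def mem qz slice_embed_simps)
    have in_dom: "slice_embed J w \<in> recip_domain \<Omega> f"
      if "slice_embed J w \<in> \<Omega>" "J \<in> imag_units" "J \<in> A" "w \<in> N'" for J w
      using that sym[of J w] by (auto simp: mem N'_def slice_embed_eq_0_iff)
    have opC: "open (half_coord -` N')"
      by (rule open_vimage[OF opN' continuous_half_coord])
    show ?thesis
    proof (cases "Im z = 0")
      case True
      have "\<Omega> \<inter> half_coord -` N' \<subseteq> recip_domain \<Omega> f"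
      proof
        fix p assume p: "p \<in> \<Omega> \<inter> half_coord -` N'"
        obtain J w where J: "J \<in> imag_units" "p = slice_embed J w" "0 \<le> Im w"
          using exists_slice by blast
        then show "p \<in> recip_domain \<Omega> f"
          using in_dom[of J w] p half_coord_slice_embed A(3)[OF True] by auto
      qed
      then show ?thesis
        using op opC z zN' half_coord_slice_embed[OF I qz(2)]
        by (intro exI[of _ "\<Omega> \<inter> half_coord -` N'"]) (auto simp: qz)
    next
      case False
      define R where "R = {p. p \<notin> (\<real> :: quat set)}"
      have R: "R = qim -` (- {0})"
        by (auto simp: R_def qim_eq_0_iff)
      have opR: "open R"
        unfolding R by (rule open_vimage[OF open_Compl continuous_qim]) simp
      have "continuous_on R unit_of"
        unfolding unit_of_def by (intro continuous_intros continuous_qim) (auto simp: R)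
      then have opU: "open (R \<inter> unit_of -` A)"
        using continuous_open_preimage opR A(1) by blast
      have "\<Omega> \<inter> half_coord -` N' \<inter> (R \<inter> unit_of -` A) \<subseteq> recip_domain \<Omega> f"
      proof
        fix p assume p: "p \<in> \<Omega> \<inter> half_coord -` N' \<inter> (R \<inter> unit_of -` A)"
        then show "p \<in> recip_domain \<Omega> f"
          using in_dom[of "unit_of p" "half_coord p"] unit_of_imag_units[of p]
            slice_embed_half_coord[of p] by (auto simp: R_def)
      qed
      moreover have "q \<in> \<Omega> \<inter> half_coord -` N' \<inter> (R \<inter> unit_of -` A)"
        using z zN' A(2) False half_coord_slice_embed[OF I qz(2)] unit_of_slice_embed[OF I, of z] qz(2)
        by (auto simp: qz(1) R_def slice_embed_in_Reals_iff[OF I])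
      ultimately show ?thesis
        using op opC opU by (intro exI[of _ "\<Omega> \<inter> half_coord -` N' \<inter> (R \<inter> unit_of -` A)"]) auto
    qed
  qed
qed

lemma open_imp_fsigma:
  fixes S :: "'a::metric_space set"
  assumes "open S"
  shows "fsigma S"
proof -
  have "fsigma_in euclidean S"
    using assms by (simp add: open_imp_fsigma_in metrizable_space_euclidean)
  then obtain C :: "nat \<Rightarrow> 'a set" where "\<And>n. closed (C n)" "\<Union> (range C) = S"
    by (auto simp: fsigma_in_ascending)
  then show ?thesis
    using fsigma.intros by metis
qed

text \<open>
  Connectedness holds on each slice, where only countably many points are removed, and the slices
  meet in a real point.
\<close>

lemma slice_domain_recip_domain:
  assumes \<Omega>: "slice_domain \<Omega>" and f: "slice_regular_on \<Omega> f" and nz: "\<exists>q\<in>\<Omega>. f q \<noteq> 0"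
  shows "slice_domain (recip_domain \<Omega> f)"
proof -
  define \<Omega>' where "\<Omega>' = recip_domain \<Omega> f"
  have op: "open \<Omega>"
    using \<Omega> by (simp add: slice_domain_def)
  have op': "open \<Omega>'"
    unfolding \<Omega>'_def by (rule open_recip_domain[OF \<Omega> f])
  have mem: "p \<in> \<Omega>' \<longleftrightarrow> p \<in> \<Omega> \<and> symmetrization \<Omega> f p \<noteq> 0" for p
    by (auto simp: \<Omega>'_def recip_domain_def zero_set_def)
  have zero: "slice_regular_on \<Omega> (\<lambda>_. 0)"
    by (rule slice_diff_imp_slice_regular[OF op]) (rule slice_diff_const)
  obtain x where x: "of_real x \<in> \<Omega>" "f (of_real x) \<noteq> 0"
    using slice_regular_identity[OF \<Omega> f zero] nz by blast
  then have x': "of_real x \<in> \<Omega>'"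
    by (simp add: mem symmetrization_def)
  have conn: "connected (slice_embed I -` \<Omega>')" if I: "I \<in> imag_units" for I
  proof -
    define D where "D = slice_embed I -` \<Omega>"
    have D: "open D" "connected D"
      using open_slice[OF op] slice_connected[OF \<Omega> I] by (auto simp: D_def)
    obtain \<phi> where hol: "\<phi> holomorphic_on D"
      and \<phi>: "\<And>z. z \<in> D \<Longrightarrow> symmetrization \<Omega> f (slice_embed I z) = slice_embed I (\<phi> z)"
      using symmetrization_holomorphic[OF \<Omega> f I] unfolding D_def by (metis vimageD)
    have D': "slice_embed I -` \<Omega>' = D - {z \<in> D. \<phi> z = 0}"
      using \<phi> by (auto simp: mem D_def slice_embed_eq_0_iff[OF I])
    have "complex_of_real x \<in> slice_embed I -` \<Omega>'"
      using x' by (simp add: slice_embed_real)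
    then have xD: "complex_of_real x \<in> D" "\<phi> (complex_of_real x) \<noteq> 0"
      unfolding D' by auto
    have "countable {z \<in> D. \<phi> z = 0}"
    proof (cases "\<phi> constant_on D")
      case True
      then have "{z \<in> D. \<phi> z = 0} = {}"
        using xD unfolding constant_on_def by fastforce
      then show ?thesis
        by (simp only: countable_empty)
    next
      case False
      then show ?thesis
        using holomorphic_countable_zeros[OF hol D open_imp_fsigma[OF D(1)]] by blast
    qed
    then show ?thesis
      unfolding D' using D by (intro connected_open_diff_countable) auto
  qed
  have cover: "\<Omega>' = (\<Union>I\<in>imag_units. \<Omega>' \<inter> slice_plane I)"
    using exists_slice by (fastforce simp: slice_plane_eq)
  have real: "of_real x \<in> slice_plane I" for I
    by (auto simp: slice_plane_eq image_iff intro!: exI[of _ "complex_of_real x"] simp: slice_embed_real)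
  have "connected \<Omega>'"
    by (subst cover, rule connected_Union)
      (use conn connected_slice real x' in auto)
  moreover have "openin (top_of_set (slice_plane I)) (\<Omega>' \<inter> slice_plane I)" for I
    using openin_open_Int[OF op', of "slice_plane I"] by (simp add: Int_commute)
  ultimately show ?thesis
    unfolding slice_domain_def \<Omega>'_def[symmetric]
    using op' x' real conn by (auto simp: connected_slice)
qed

section \<open>The reciprocal\<close>

lemma regular_recip_eq_inverse_conj:
  assumes I: "I \<in> imag_units" and aff: "sphere_affine \<Omega> f I z b c"
  shows "regular_recip \<Omega> f (slice_embed I z)
    = inverse (symmetrization \<Omega> f (slice_embed I z)) * regular_conj \<Omega> f (slice_embed I z)"
  by (simp only: regular_recip_eq[OF assms] recip_coeff_conj[OF I] symmetrization_eq[OF assms]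
      regular_conj_eq[OF assms] slice_embed_inverse[OF I])

lemma slice_regular_recip:
  assumes \<Omega>: "slice_domain \<Omega>" and f: "slice_regular_on \<Omega> f"
  shows "slice_regular_on (recip_domain \<Omega> f) (regular_recip \<Omega> f)"
proof (rule slice_diff_imp_slice_regular[OF open_recip_domain[OF assms]])
  fix I z assume I: "I \<in> imag_units" and z: "slice_embed I z \<in> recip_domain \<Omega> f"
  have op: "open \<Omega>"
    using \<Omega> by (simp add: slice_domain_def)
  have z\<Omega>: "slice_embed I z \<in> \<Omega>" and nz: "symmetrization \<Omega> f (slice_embed I z) \<noteq> 0"
    using z by (auto simp: recip_domain_def zero_set_def)
  define D where "D = slice_embed I -` \<Omega>"
  have D: "open D" "z \<in> D"
    using open_slice[OF op] z\<Omega> by (auto simp: D_def)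
  obtain \<phi> where hol: "\<phi> holomorphic_on D"
    and \<phi>: "\<And>w. w \<in> D \<Longrightarrow> symmetrization \<Omega> f (slice_embed I w) = slice_embed I (\<phi> w)"
    using symmetrization_holomorphic[OF \<Omega> f I] unfolding D_def by (metis vimageD)
  have "\<phi> z \<noteq> 0"
    using nz \<phi>[OF D(2)] by (auto simp: slice_embed_simps)
  moreover obtain \<phi>' where "(\<phi> has_field_derivative \<phi>') (at z)"
    using hol D by (auto simp: holomorphic_on_open)
  ultimately obtain \<psi>' where "((\<lambda>w. inverse (\<phi> w)) has_field_derivative \<psi>') (at z)"
    using DERIV_inverse_fun by blast
  moreover have "slice_diff I (\<lambda>w. regular_conj \<Omega> f (slice_embed I w)) z"
    using slice_regular_imp_slice_diff[OF op slice_regular_conj[OF \<Omega> f] I z\<Omega>] .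
  ultimately have diff: "slice_diff I (\<lambda>w. slice_embed I (inverse (\<phi> w)) * regular_conj \<Omega> f (slice_embed I w)) z"
    by (rule slice_diff_embed_mult[OF I])
  show "slice_diff I (\<lambda>w. regular_recip \<Omega> f (slice_embed I w)) z"
  proof (rule slice_diff_cong_open[OF diff D])
    fix w assume w: "w \<in> D"
    then obtain b c where "sphere_affine \<Omega> f I w b c"
      using sphere_affine_exists[OF \<Omega> f I, of w] by (auto simp: D_def)
    from regular_recip_eq_inverse_conj[OF I this]
    show "slice_embed I (inverse (\<phi> w)) * regular_conj \<Omega> f (slice_embed I w)
        = regular_recip \<Omega> f (slice_embed I w)"
      by (simp add: \<phi>[OF w] slice_embed_inverse[OF I])
  qed
qed

text \<open>
  On a single sphere all functions involved have explicit spherical coefficients, and the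
  identities hold because the complexified quaternion \<open>p + \<iota> q\<close> below is a two-sided
  inverse of \<open>b + \<iota> c\<close>.
\<close>

lemma reciprocal_identities:
  assumes I: "I \<in> imag_units" and aff: "sphere_affine \<Omega> f I z b c"
    and \<Omega>': "open \<Omega>'" "slice_embed I z \<in> \<Omega>'"
    and nz: "symmetrization \<Omega> f (slice_embed I z) \<noteq> 0"
  shows "symmetrization \<Omega> (symmetrization \<Omega> f) (slice_embed I z) \<noteq> 0"
    and "regular_recip \<Omega> f (slice_embed I z)
      = regular_prod \<Omega>' (regular_recip \<Omega> (symmetrization \<Omega> f)) (regular_conj \<Omega> f) (slice_embed I z)"
    and "regular_prod \<Omega>' f (regular_recip \<Omega> f) (slice_embed I z) = 1"
    and "regular_prod \<Omega>' (regular_recip \<Omega> f) f (slice_embed I z) = 1"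
proof -
  define \<phi> where "\<phi> = stem_sym b c"
  define p where "p = recip_coeff b c"
  define q where "q = - recip_coeff c b"
  have \<phi>0: "\<phi> \<noteq> 0"
    using nz by (auto simp: symmetrization_eq[OF I aff] \<phi>_def slice_embed_simps)
  have sym: "sphere_affine \<Omega> (symmetrization \<Omega> f) I z (of_real (Re \<phi>)) (of_real (Im \<phi>))"
  proof (rule sphere_affine_transfer[OF aff])
    fix J assume "J \<in> imag_units" "sphere_affine \<Omega> f J z b c"
    from symmetrization_eq[OF this]
    show "symmetrization \<Omega> f (slice_embed J z) = of_real (Re \<phi>) + J * of_real (Im \<phi>)"
      by (simp add: \<phi>_def slice_embed_eq[of J "stem_sym b c"] of_real_def)
  qed
  show "symmetrization \<Omega> (symmetrization \<Omega> f) (slice_embed I z) \<noteq> 0"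
    using \<phi>0 by (simp add: symmetrization_eq[OF I sym] stem_sym_of_real slice_embed_eq_0_iff[OF I])
  have conj: "sphere_affine \<Omega> (regular_conj \<Omega> f) I z (qcnj b) (qcnj c)"
    by (rule sphere_affine_transfer[OF aff]) (rule regular_conj_eq)
  have recip: "sphere_affine \<Omega> (regular_recip \<Omega> f) I z p q"
    unfolding p_def q_def by (rule sphere_affine_transfer[OF aff]) (rule regular_recip_eq)
  have recip_sym: "sphere_affine \<Omega> (regular_recip \<Omega> (symmetrization \<Omega> f)) I z
      (of_real (Re (inverse \<phi>))) (of_real (Im (inverse \<phi>)))"
    unfolding recip_coeff_of_real[symmetric]
    by (rule sphere_affine_transfer[OF sym]) (rule regular_recip_eq)
  note sub = sphere_affine_subdomain[OF _ \<Omega>']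
  have inv: "b * p - c * q = 1" "b * q + c * p = 0" "p * b - q * c = 1" "p * c + q * b = 0"
    using recip_coeff_inverse \<phi>0 unfolding p_def q_def \<phi>_def by blast+
  show "regular_prod \<Omega>' f (regular_recip \<Omega> f) (slice_embed I z) = 1"
    by (simp add: regular_prod_eq[OF I sub[OF aff] sub[OF recip]] inv)
  show "regular_prod \<Omega>' (regular_recip \<Omega> f) f (slice_embed I z) = 1"
    by (simp add: regular_prod_eq[OF I sub[OF recip] sub[OF aff]] inv)
  have "regular_prod \<Omega>' (regular_recip \<Omega> (symmetrization \<Omega> f)) (regular_conj \<Omega> f) (slice_embed I z)
      = slice_embed I (inverse \<phi>) * (qcnj b + I * qcnj c)"
    unfolding regular_prod_eq[OF I sub[OF recip_sym] sub[OF conj]]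
    by (simp add: slice_embed_eq of_real_def algebra_simps imag_unit_sq_mult[OF I]
        del: inverse_complex.sel)
  then show "regular_recip \<Omega> f (slice_embed I z)
      = regular_prod \<Omega>' (regular_recip \<Omega> (symmetrization \<Omega> f)) (regular_conj \<Omega> f) (slice_embed I z)"
    by (simp only: regular_recip_eq[OF I aff] recip_coeff_conj[OF I] \<phi>_def)
qed

text \<open>
  A slice preserving function is real on the real axis, where it therefore agrees with its
  regular conjugate; hence the two agree everywhere.
\<close>

lemma slice_preserving_conj:
  assumes \<Omega>: "slice_domain \<Omega>" and f: "slice_regular_on \<Omega> f" and pres: "slice_preserving_on \<Omega> f"
    and q: "q \<in> \<Omega>"
  shows "regular_conj \<Omega> f q = f q"
proof (rule slice_regular_identity[OF \<Omega> slice_regular_conj[OF \<Omega> f] f _ q])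
  fix x :: real assume x: "of_real x \<in> \<Omega>"
  have "f (of_real x) \<in> slice_plane I" if I: "I \<in> imag_units" for I
  proof -
    have "of_real x \<in> \<Omega> \<inter> slice_plane I"
      using x by (auto simp: slice_plane_eq image_iff slice_embed_real intro!: exI[of _ "complex_of_real x"])
    then show ?thesis
      using pres I by (auto simp: slice_preserving_on_def)
  qed
  from this[OF quat_unit_i] this[OF quat_unit_j]
  have "qcnj (f (of_real x)) = f (of_real x)"
    by (auto simp: slice_plane_eq slice_embed_eq quat_eq_iff)
  then show "regular_conj \<Omega> f (of_real x) = f (of_real x)"
    by (simp add: regular_conj_def)
qed

lemma slice_preserving_recip:
  assumes \<Omega>: "slice_domain \<Omega>" and f: "slice_regular_on \<Omega> f" and pres: "slice_preserving_on \<Omega> f"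
    and I: "I \<in> imag_units" and z: "slice_embed I z \<in> recip_domain \<Omega> f"
  shows "f (slice_embed I z) \<noteq> 0"
    and "regular_recip \<Omega> f (slice_embed I z) = inverse (f (slice_embed I z))"
    and "regular_recip \<Omega> f (slice_embed I z) \<in> slice_plane I"
proof -
  have z\<Omega>: "slice_embed I z \<in> \<Omega>" and nz: "symmetrization \<Omega> f (slice_embed I z) \<noteq> 0"
    using z by (auto simp: recip_domain_def zero_set_def)
  obtain b c where aff: "sphere_affine \<Omega> f I z b c"
    by (rule sphere_affine_exists[OF \<Omega> f I z\<Omega>])
  have "sphere_affine \<Omega> f I z (qcnj b) (qcnj c)"
  proof (rule sphere_affine_transfer[OF aff])
    fix J assume J: "J \<in> imag_units" "sphere_affine \<Omega> f J z b c"
    then show "f (slice_embed J z) = qcnj b + J * qcnj c"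
      using slice_preserving_conj[OF \<Omega> f pres] sphere_affineD by (simp flip: regular_conj_eq)
  qed
  then have "qcnj b = b" "qcnj c = c"
    using sphere_affine_unique[OF I aff] by metis+
  then have "b = of_real (qre b)" "c = of_real (qre c)"
    by (simp_all add: quat_eq_iff)
  then obtain \<zeta> where bc: "b = of_real (Re \<zeta>)" "c = of_real (Im \<zeta>)"
    by (metis complex.sel)
  have "f (slice_embed I z) = b + I * c"
    using sphere_affineD[OF aff I] by blast
  also have "\<dots> = slice_embed I \<zeta>"
    by (simp add: bc slice_embed_eq of_real_def)
  finally have f\<zeta>: "f (slice_embed I z) = slice_embed I \<zeta>" .
  have sym: "symmetrization \<Omega> f (slice_embed I z) = slice_embed I (\<zeta>\<^sup>2)"
    unfolding symmetrization_eq[OF I aff] bc stem_sym_of_real ..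
  have \<zeta>: "\<zeta> \<noteq> 0"
    using nz by (auto simp: sym slice_embed_simps)
  then show "f (slice_embed I z) \<noteq> 0"
    by (simp add: f\<zeta> slice_embed_eq_0_iff[OF I])
  have "regular_recip \<Omega> f (slice_embed I z) = inverse (slice_embed I (\<zeta>\<^sup>2)) * slice_embed I \<zeta>"
    by (simp only: regular_recip_eq_inverse_conj[OF I aff] sym slice_preserving_conj[OF \<Omega> f pres z\<Omega>] f\<zeta>)
  also have "\<dots> = slice_embed I (inverse (\<zeta>\<^sup>2) * \<zeta>)"
    by (simp add: slice_embed_inverse[OF I] slice_embed_mult[OF I])
  also have "inverse (\<zeta>\<^sup>2) * \<zeta> = inverse \<zeta>"
    using \<zeta> by (simp add: power2_eq_square)
  finally have eq: "regular_recip \<Omega> f (slice_embed I z) = slice_embed I (inverse \<zeta>)" .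
  then show "regular_recip \<Omega> f (slice_embed I z) = inverse (f (slice_embed I z))"
    by (simp add: f\<zeta> slice_embed_inverse[OF I])
  show "regular_recip \<Omega> f (slice_embed I z) \<in> slice_plane I"
    by (simp add: eq slice_plane_eq)
qed

theorem proposition6p2:
  fixes \<Omega> :: "quat set" and f :: "quat \<Rightarrow> quat"
  assumes "slice_domain \<Omega>"
    and "slice_regular_on \<Omega> f"
    and "\<exists>q\<in>\<Omega>. f q \<noteq> 0"
  shows "let \<Omega>' = recip_domain \<Omega> f; fc = regular_conj \<Omega> f; fs = symmetrization \<Omega> f;
             fr = regular_recip \<Omega> f
         in slice_domain \<Omega>' \<and> slice_regular_on \<Omega>' fr \<and>
            \<Omega>' \<subseteq> recip_domain \<Omega> fs \<and>
            (\<forall>q\<in>\<Omega>'. fr q = regular_prod \<Omega>' (regular_recip \<Omega> fs) fc q \<and>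
                    fr q = inverse (fs q) * fc q) \<and>
            (\<forall>q\<in>\<Omega>'. regular_prod \<Omega>' f fr q = 1 \<and> regular_prod \<Omega>' fr f q = 1) \<and>
            (slice_preserving_on \<Omega> f \<longrightarrow>
               slice_preserving_on \<Omega>' fr \<and>
               (\<forall>q\<in>\<Omega>'. f q \<noteq> 0 \<and> fr q = inverse (f q)))"
proof -
  define \<Omega>' where "\<Omega>' = recip_domain \<Omega> f"
  have op': "open \<Omega>'"
    unfolding \<Omega>'_def by (rule open_recip_domain[OF assms(1,2)])
  have pointwise: "symmetrization \<Omega> (symmetrization \<Omega> f) q \<noteq> 0 \<and> q \<in> \<Omega> \<and>
      regular_recip \<Omega> f q = regular_prod \<Omega>' (regular_recip \<Omega> (symmetrization \<Omega> f)) (regular_conj \<Omega> f) q \<and>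
      regular_recip \<Omega> f q = inverse (symmetrization \<Omega> f q) * regular_conj \<Omega> f q \<and>
      regular_prod \<Omega>' f (regular_recip \<Omega> f) q = 1 \<and> regular_prod \<Omega>' (regular_recip \<Omega> f) f q = 1"
    if q: "q \<in> \<Omega>'" for q
  proof -
    obtain I z where I: "I \<in> imag_units" and qz: "q = slice_embed I z"
      using exists_slice by blast
    have z: "slice_embed I z \<in> \<Omega>" "slice_embed I z \<in> \<Omega>'" "symmetrization \<Omega> f (slice_embed I z) \<noteq> 0"
      using q by (auto simp: qz \<Omega>'_def recip_domain_def zero_set_def)
    obtain b c where aff: "sphere_affine \<Omega> f I z b c"
      by (rule sphere_affine_exists[OF assms(1,2) I z(1)])
    show ?thesis
      unfolding qz
      using reciprocal_identities[OF I aff op' z(2,3)] regular_recip_eq_inverse_conj[OF I aff] z(1)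
      by blast
  qed
  have "slice_domain \<Omega>'"
    unfolding \<Omega>'_def by (rule slice_domain_recip_domain[OF assms])
  moreover have "slice_regular_on \<Omega>' (regular_recip \<Omega> f)"
    unfolding \<Omega>'_def by (rule slice_regular_recip[OF assms(1,2)])
  moreover have "\<Omega>' \<subseteq> recip_domain \<Omega> (symmetrization \<Omega> f)"
    using pointwise by (auto simp: recip_domain_def zero_set_def)
  moreover have "slice_preserving_on \<Omega>' (regular_recip \<Omega> f) \<and>
      (\<forall>q\<in>\<Omega>'. f q \<noteq> 0 \<and> regular_recip \<Omega> f q = inverse (f q))" if pres: "slice_preserving_on \<Omega> f"
  proof
    note * = slice_preserving_recip[OF assms(1,2) pres, folded \<Omega>'_def]
    show "slice_preserving_on \<Omega>' (regular_recip \<Omega> f)"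
      unfolding slice_preserving_on_def using *(3) by (auto simp: slice_plane_Int_eq)
    show "\<forall>q\<in>\<Omega>'. f q \<noteq> 0 \<and> regular_recip \<Omega> f q = inverse (f q)"
      using *(1,2) exists_slice by metis
  qed
  ultimately show ?thesis
    unfolding Let_def \<Omega>'_def[symmetric] using pointwise by blast
qed

end
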